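(* Let $\mathbf{k}$ be a commutative ring, $\lambda\in\mathbf{k}$ and $X$ a non-empty set. The quadruple $(\mathbf{k}\mathcal{V}(X),\diamond_v,/\ \backslash,j_X)$ (resp. $(\mathbf{k}(\mathcal{V}(X)\cap\mathcal{L}(X)),\diamond_v,/\ \backslash,j_X)$) is the free Rota–Baxter algebra (resp. free nonunitary Rota–Baxter algebra) of weight $\lambda$ on $X$.
   Context: **Rota–Baxter algebras.** A (nonunitary) Rota–Baxter algebra of weight $\lambda$ is an associative unitary (resp. not necessarily unitary) $\mathbf{k}$-algebra $A$ with a $\mathbf{k}$-linear operator $P$ satisfying $P(x)P(y)=P(xP(y))+P(P(x)y)+\lambda P(xy)$ for all $x,y\in A$. Morphisms are algebra homomorphisms (unitary, resp. nonunitary) commuting with the operators. The free (nonunitary) Rota–Baxter algebra of weight $\lambda$ on $X$ is one, $U_X$, with a map of sets $j_X:X\to U_X$ such that for every (nonunitary) Rota–Baxter algebra $R$ of weight $\lambda$ and map of sets $f:X\to R$ there is a unique morphism $\bar f:U_X\to R$ with $f=\bar f\circ j_X$. For a set $Y$, $\mathbf{k}Y$ is the free $\mathbf{k}$-module with basis $Y$. **Motzkin paths.** A Motzkin path is a lattice path in $\mathbb{N}^2$ (with $\mathbb{N}$ the non-negative integers) from $(0,0)$ to some $(n,0)$, $n\ge0$, with steps $(1,1)$ (up), $(1,-1)$ (down), $(1,0)$ (level). $\mathcal{P}(X)$ is the set of Motzkin paths with level steps decorated by $X$; $\bullet$ is the trivial one-point path; $\ell_x$ is the path consisting of one level step decorated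 by $x$. $\circ$ is the link product (joining paths end to end), extended multilinearly; the raising operator $/\,\mathfrak{m}\,\backslash$ adds an up step at the left end and a down step at the right end, extended linearly. A path is indecomposable if it touches the $x$-axis only at its two end vertices; an indecomposable path is $\bullet$, some $\ell_x$, or $/\,\bar{\mathfrak{m}}\,\backslash$ for a path $\bar{\mathfrak m}$. $\mathcal{V}(X)\subseteq\mathcal{P}(X)$ is the set of valley-free paths (no down step immediately followed by an up step), and $\mathcal{L}(X)\subseteq\mathcal{P}(X)$ the set of peak-free paths (not $\bullet$, and with no up step immediately followed by a down step). **Product.** $\diamond_v$ is the bilinear product on $\mathbf{k}\mathcal{V}(X)$ defined recursively and characterized by: (1) $\bullet$ is the identity; (2) for indecomposable $\mathfrak{m},\mathfrak{m}'\in\mathcal{V}(X)\setminus\{\bullet\}$, $\mathfrak{m}\diamond_v\mathfrak{m}'=\mathfrak{m}\circ\mathfrak{m}'$ if $\mathfrak{m}=\ell_x$ or $\mathfrak{m}'=\ell_{x'}$ for some $x,x'\in X$, and $\mathfrak{m}\diamond_v\mathfrak{m}'=/\,\bar{\mathfrak{m}}\diamond_v\mathfrak{m}'\,\backslash+/\,\mathfrak{m}\diamond_v\bar{\mathfrak{m}}'\,\backslash+\lambda/\,\bar{\mathfrak{m}}\diamond_v\bar{\mathfrak{m}}'\,\backslash$ if $\mathfrak{m}=/\,\bar{\mathfrak{m}}\,\backslash$, $\mathfrak{m}'=/\,\bar{\mathfrak{m}}'\,\backslash$; (3) if $\mathfrak{m}=\mathfrak{m}_1\circ\cdots\circ\mathfrak{m}_p$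 and $\mathfrak{m}'=\mathfrak{m}'_1\circ\cdots\circ\mathfrak{m}'_{p'}$ are the decompositions of non-trivial paths into non-trivial indecomposable paths, then $\mathfrak{m}\diamond_v\mathfrak{m}'=\mathfrak{m}_1\circ\cdots\circ\mathfrak{m}_{p-1}\circ(\mathfrak{m}_p\diamond_v\mathfrak{m}'_1)\circ\mathfrak{m}'_2\circ\cdots\circ\mathfrak{m}'_{p'}$. It restricts to $\mathbf{k}(\mathcal{V}(X)\cap\mathcal{L}(X))$. The map $j_X$ sends $x\in X$ to $\ell_x$. *)

theory Defs
  imports "HOL-Algebra.Module" "HOL-Library.FuncSet"
begin

section \<open>Rota--Baxter algebras\<close>

record ('k, 'a) rb_algebra = "('k, 'a) module" +
  rb_op :: "'a \<Rightarrow> 'a"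

text \<open>
  The library locale \<open>algebra\<close> is about commutative algebras, hence the associative algebras below
  are built on \<open>module\<close>. In the nonunitary case the field \<open>one\<close> of the record is meaningless:
  it need not even lie in the carrier.
\<close>

locale nonunitary_rota_baxter_algebra = module k A
  for k :: "('k, 'm) ring_scheme" and A :: "('k, 'a) rb_algebra" and lam :: 'k +
  assumes weight_closed: "lam \<in> carrier k"
    and mult_closed:
      "\<lbrakk>x \<in> carrier A; y \<in> carrier A\<rbrakk> \<Longrightarrow> x \<otimes>\<^bsub>A\<^esub> y \<in> carrier A"
    and mult_assoc:
      "\<lbrakk>x \<in> carrier A; y \<in> carrier A; z \<in> carrier A\<rbrakk> \<Longrightarrow>
        (x \<otimes>\<^bsub>A\<^esub> y) \<otimes>\<^bsub>A\<^esub> z = x \<otimes>\<^bsub>A\<^esub> (y \<otimes>\<^bsub>A\<^esub> z)"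
    and mult_add_left:
      "\<lbrakk>x \<in> carrier A; y \<in> carrier A; z \<in> carrier A\<rbrakk> \<Longrightarrow>
        (x \<oplus>\<^bsub>A\<^esub> y) \<otimes>\<^bsub>A\<^esub> z = (x \<otimes>\<^bsub>A\<^esub> z) \<oplus>\<^bsub>A\<^esub> (y \<otimes>\<^bsub>A\<^esub> z)"
    and mult_add_right:
      "\<lbrakk>x \<in> carrier A; y \<in> carrier A; z \<in> carrier A\<rbrakk> \<Longrightarrow>
        z \<otimes>\<^bsub>A\<^esub> (x \<oplus>\<^bsub>A\<^esub> y) = (z \<otimes>\<^bsub>A\<^esub> x) \<oplus>\<^bsub>A\<^esub> (z \<otimes>\<^bsub>A\<^esub> y)"
    and mult_smult_left:
      "\<lbrakk>c \<in> carrier k; x \<in> carrier A; y \<in> carrier A\<rbrakk> \<Longrightarrow>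
        (c \<odot>\<^bsub>A\<^esub> x) \<otimes>\<^bsub>A\<^esub> y = c \<odot>\<^bsub>A\<^esub> (x \<otimes>\<^bsub>A\<^esub> y)"
    and mult_smult_right:
      "\<lbrakk>c \<in> carrier k; x \<in> carrier A; y \<in> carrier A\<rbrakk> \<Longrightarrow>
        x \<otimes>\<^bsub>A\<^esub> (c \<odot>\<^bsub>A\<^esub> y) = c \<odot>\<^bsub>A\<^esub> (x \<otimes>\<^bsub>A\<^esub> y)"
    and op_closed: "x \<in> carrier A \<Longrightarrow> rb_op A x \<in> carrier A"
    and op_add:
      "\<lbrakk>x \<in> carrier A; y \<in> carrier A\<rbrakk> \<Longrightarrow>
        rb_op A (x \<oplus>\<^bsub>A\<^esub> y) = rb_op A x \<oplus>\<^bsub>A\<^esub> rb_op A y"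
    and op_smult:
      "\<lbrakk>c \<in> carrier k; x \<in> carrier A\<rbrakk> \<Longrightarrow> rb_op A (c \<odot>\<^bsub>A\<^esub> x) = c \<odot>\<^bsub>A\<^esub> rb_op A x"
    and rota_baxter:
      "\<lbrakk>x \<in> carrier A; y \<in> carrier A\<rbrakk> \<Longrightarrow>
        rb_op A x \<otimes>\<^bsub>A\<^esub> rb_op A y =
          rb_op A (x \<otimes>\<^bsub>A\<^esub> rb_op A y) \<oplus>\<^bsub>A\<^esub> rb_op A (rb_op A x \<otimes>\<^bsub>A\<^esub> y)
            \<oplus>\<^bsub>A\<^esub> lam \<odot>\<^bsub>A\<^esub> rb_op A (x \<otimes>\<^bsub>A\<^esub> y)"

locale rota_baxter_algebra = nonunitary_rota_baxter_algebra k A lam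
  for k :: "('k, 'm) ring_scheme" and A :: "('k, 'a) rb_algebra" and lam :: 'k +
  assumes unit_closed: "\<one>\<^bsub>A\<^esub> \<in> carrier A"
    and mult_unit_left: "x \<in> carrier A \<Longrightarrow> \<one>\<^bsub>A\<^esub> \<otimes>\<^bsub>A\<^esub> x = x"
    and mult_unit_right: "x \<in> carrier A \<Longrightarrow> x \<otimes>\<^bsub>A\<^esub> \<one>\<^bsub>A\<^esub> = x"

definition nonunitary_rb_hom ::
  "('k, 'm) ring_scheme \<Rightarrow> ('k, 'a) rb_algebra \<Rightarrow> ('k, 'b) rb_algebra \<Rightarrow> ('a \<Rightarrow> 'b) set" where
  "nonunitary_rb_hom k A B =
    {h. h \<in> carrier A \<rightarrow> carrier B
      \<and> (\<forall>x\<in>carrier A. \<forall>y\<in>carrier A. h (x \<oplus>\<^bsub>A\<^esub> y) = h x \<oplus>\<^bsub>B\<^esub> h y)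
      \<and> (\<forall>c\<in>carrier k. \<forall>x\<in>carrier A. h (c \<odot>\<^bsub>A\<^esub> x) = c \<odot>\<^bsub>B\<^esub> h x)
      \<and> (\<forall>x\<in>carrier A. \<forall>y\<in>carrier A. h (x \<otimes>\<^bsub>A\<^esub> y) = h x \<otimes>\<^bsub>B\<^esub> h y)
      \<and> (\<forall>x\<in>carrier A. h (rb_op A x) = rb_op B (h x))}"

definition rb_hom ::
  "('k, 'm) ring_scheme \<Rightarrow> ('k, 'a) rb_algebra \<Rightarrow> ('k, 'b) rb_algebra \<Rightarrow> ('a \<Rightarrow> 'b) set" where
  "rb_hom k A B = {h \<in> nonunitary_rb_hom k A B. h \<one>\<^bsub>A\<^esub> = \<one>\<^bsub>B\<^esub>}"

text \<open>
  A definition in HOL cannot quantify over all types, so the type \<open>'r\<close> of the elements of the target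
  algebras is an explicit parameter \<open>TYPE('r)\<close>. Freeness is stated by leaving \<open>'r\<close> a free type
  variable. Restricting the morphism to \<open>extensional\<close> functions makes its uniqueness as a HOL
  function the same as uniqueness on the carrier.
\<close>

definition free_rota_baxter_algebra ::
  "'r itself \<Rightarrow> ('k, 'm) ring_scheme \<Rightarrow> 'k \<Rightarrow> 'x set \<Rightarrow> ('k, 'u) rb_algebra \<Rightarrow> ('x \<Rightarrow> 'u) \<Rightarrow> bool"
  where
  "free_rota_baxter_algebra _ k lam X U j \<longleftrightarrow>
    rota_baxter_algebra k U lam \<and> j \<in> X \<rightarrow> carrier U \<and>
    (\<forall>(R :: ('k, 'r) rb_algebra) f.
      rota_baxter_algebra k R lam \<longrightarrow> f \<in> X \<rightarrow> carrier R \<longrightarrow>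
      (\<exists>!h. h \<in> rb_hom k U R \<inter> extensional (carrier U) \<and> (\<forall>x\<in>X. f x = h (j x))))"

definition free_nonunitary_rota_baxter_algebra ::
  "'r itself \<Rightarrow> ('k, 'm) ring_scheme \<Rightarrow> 'k \<Rightarrow> 'x set \<Rightarrow> ('k, 'u) rb_algebra \<Rightarrow> ('x \<Rightarrow> 'u) \<Rightarrow> bool"
  where
  "free_nonunitary_rota_baxter_algebra _ k lam X U j \<longleftrightarrow>
    nonunitary_rota_baxter_algebra k U lam \<and> j \<in> X \<rightarrow> carrier U \<and>
    (\<forall>(R :: ('k, 'r) rb_algebra) f.
      nonunitary_rota_baxter_algebra k R lam \<longrightarrow> f \<in> X \<rightarrow> carrier R \<longrightarrow>
      (\<exists>!h. h \<in> nonunitary_rb_hom k U R \<inter> extensional (carrier U) \<and> (\<forall>x\<in>X. f x = h (j x))))"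


section \<open>Free modules\<close>

text \<open>The free \<open>k\<close>-module \<open>kY\<close> is realized as the finitely
  supported functions with values in \<open>k\<close> vanishing off \<open>Y\<close>.\<close>

definition supp :: "('k, 'm) ring_scheme \<Rightarrow> ('y \<Rightarrow> 'k) \<Rightarrow> 'y set" where
  "supp k u = {y. u y \<noteq> \<zero>\<^bsub>k\<^esub>}"

definition free_module :: "('k, 'm) ring_scheme \<Rightarrow> 'y set \<Rightarrow> ('y \<Rightarrow> 'k) set" where
  "free_module k Y = {u. (\<forall>y. u y \<in> carrier k) \<and> finite (supp k u) \<and> supp k u \<subseteq> Y}"

definition basis :: "('k, 'm) ring_scheme \<Rightarrow> 'y \<Rightarrow> ('y \<Rightarrow> 'k)" where
  "basis k y = (\<lambda>z. if z = y then \<one>\<^bsub>k\<^esub> else \<zero>\<^bsub>k\<^esub>)"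

text \<open>The linear map sending the basis element \<open>y\<close> to the basis element \<open>g y\<close>.\<close>

definition linear_ext :: "('k, 'm) ring_scheme \<Rightarrow> ('y \<Rightarrow> 'z) \<Rightarrow> ('y \<Rightarrow> 'k) \<Rightarrow> ('z \<Rightarrow> 'k)" where
  "linear_ext k g u = (\<lambda>z. finsum k u {y \<in> supp k u. g y = z})"

text \<open>The bilinear map sending a pair \<open>(y, y')\<close> of basis elements to \<open>B y y'\<close>.\<close>

definition bilinear_ext ::
  "('k, 'm) ring_scheme \<Rightarrow> ('y \<Rightarrow> 'y \<Rightarrow> ('z \<Rightarrow> 'k)) \<Rightarrow> ('y \<Rightarrow> 'k) \<Rightarrow> ('y \<Rightarrow> 'k) \<Rightarrow> ('z \<Rightarrow> 'k)" where
  "bilinear_ext k B u v =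
    (\<lambda>z. finsum k (\<lambda>(y, y'). (u y \<otimes>\<^bsub>k\<^esub> v y') \<otimes>\<^bsub>k\<^esub> B y y' z) (supp k u \<times> supp k v))"


section \<open>Motzkin paths\<close>

text \<open>
  A path is encoded by its list of steps; since it starts at the origin and every step advances the
  abscissa by one, the vertices are the points \<open>(i, height (take i m))\<close> for \<open>i \<le> length m\<close>.
  The trivial path is \<open>[]\<close> and the link product is \<open>@\<close>.
\<close>

datatype 'x step = Up | Down | Level 'x

type_synonym 'x path = "'x step list"

fun rise :: "'x step \<Rightarrow> int" where
  "rise Up = 1"
| "rise Down = -1"
| "rise (Level x) = 0"

definition height :: "'x path \<Rightarrow> int" where
  "height m = sum_list (map rise m)"

definition motzkin_paths :: "'x set \<Rightarrow> 'x path set" where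
  "motzkin_paths X =
    {m. (\<forall>i\<le>length m. 0 \<le> height (take i m)) \<and> height m = 0 \<and> (\<forall>x. Level x \<in> set m \<longrightarrow> x \<in> X)}"

definition raise :: "'x path \<Rightarrow> 'x path" where
  "raise m = Up # m @ [Down]"

definition indecomposable :: "'x path \<Rightarrow> bool" where
  "indecomposable m \<longleftrightarrow> (\<forall>i. 0 < i \<and> i < length m \<longrightarrow> height (take i m) \<noteq> 0)"

definition valley_free_paths :: "'x set \<Rightarrow> 'x path set" where
  "valley_free_paths X = {m \<in> motzkin_paths X. \<not> (\<exists>a b. m = a @ [Down, Up] @ b)}"

definition peak_free_paths :: "'x set \<Rightarrow> 'x path set" where
  "peak_free_paths X = {m \<in> motzkin_paths X. m \<noteq> [] \<and> \<not> (\<exists>a b. m = a @ [Up, Down] @ b)}"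

text \<open>
  The decomposition into non-trivial indecomposable paths is obtained by cutting at every vertex on
  the axis: \<open>cut_path c h m\<close> reads \<open>m\<close>, where \<open>c\<close> is the part of the current factor that has been read
  already and \<open>h\<close> is its height.
\<close>

fun cut_path :: "'x path \<Rightarrow> int \<Rightarrow> 'x path \<Rightarrow> 'x path list" where
  "cut_path c h [] = (if c = [] then [] else [c])"
| "cut_path c h (s # m) =
    (if h + rise s = 0 then (c @ [s]) # cut_path [] 0 m else cut_path (c @ [s]) (h + rise s) m)"

definition factors :: "'x path \<Rightarrow> 'x path list" where
  "factors m = cut_path [] 0 m"

text \<open>The inverse of \<^const>\<open>raise\<close>.\<close>

definition lower :: "'x path \<Rightarrow> 'x path" where
  "lower m = butlast (tl m)"

lemma length_lower: "m \<noteq> [] \<Longrightarrow> length (lower m) < length m"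
  by (cases m) (auto simp: lower_def)

lemma concat_cut_path: "concat (cut_path c h m) = c @ m"
  by (induction c h m rule: cut_path.induct) auto

lemma concat_factors: "concat (factors m) = m"
  by (simp add: factors_def concat_cut_path)

lemma length_last_factor: "m \<noteq> [] \<Longrightarrow> length (last (factors m)) \<le> length m"
  by (metis append_butlast_last_id concat.simps(1) concat_append concat_factors concat.simps(2)
      append_Nil2 length_append le_add2)

lemma length_first_factor: "m \<noteq> [] \<Longrightarrow> length (hd (factors m)) \<le> length m"
  by (metis concat.simps concat_factors hd_Cons_tl length_append le_add1)


section \<open>The product on valley-free paths\<close>

text \<open>
  The product \<open>m \<diamondop>\<^sub>v m'\<close> of two basis elements. Only the last factor of \<open>m\<close> and the first factor of
  \<open>m'\<close> interact. A non-trivial indecomposable Motzkin path is a raised path exactly if its first step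
  is \<^const>\<open>Up\<close>, and a single level step otherwise.
\<close>

function valley_prod :: "('k, 'm) ring_scheme \<Rightarrow> 'k \<Rightarrow> 'x path \<Rightarrow> 'x path \<Rightarrow> ('x path \<Rightarrow> 'k)" where
  "valley_prod k lam m m' =
    (if m = [] then basis k m'
     else if m' = [] then basis k m
     else
       let a = last (factors m); b = hd (factors m') in
       linear_ext k (\<lambda>n. concat (butlast (factors m)) @ n @ concat (tl (factors m')))
         (if a \<noteq> [] \<and> b \<noteq> [] \<and> hd a = Up \<and> hd b = Up
          then (\<lambda>z. linear_ext k raise (valley_prod k lam (lower a) b) z
              \<oplus>\<^bsub>k\<^esub> linear_ext k raise (valley_prod k lam a (lower b)) z
              \<oplus>\<^bsub>k\<^esub> lam \<otimes>\<^bsub>k\<^esub> linear_ext k raise (valley_prod k lam (lower a) (lower b)) z)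
          else basis k (a @ b)))"
  by pat_completeness auto
termination
proof (relation "measure (\<lambda>(k, lam, m, m'). length m + length m')", goal_cases)
  case 1
  show ?case by simp
next
  case (2 k lam m m' a b)
  then show ?case
    using length_last_factor[of m] length_first_factor[of m'] length_lower[of a] by auto
next
  case (3 k lam m m' a b)
  then show ?case
    using length_last_factor[of m] length_first_factor[of m'] length_lower[of b] by auto
next
  case (4 k lam m m' a b)
  then show ?case
    using length_last_factor[of m] length_first_factor[of m'] length_lower[of a] length_lower[of b]
    by auto
qed

declare valley_prod.simps [simp del]

text \<open>
  The algebra on \<open>kY\<close> for a set \<open>Y\<close> of paths, with the product \<open>\<diamondop>\<^sub>v\<close> and the raising operator.
\<close>

definition path_algebra ::
  "('k, 'm) ring_scheme \<Rightarrow> 'k \<Rightarrow> 'x path set \<Rightarrow> ('k, 'x path \<Rightarrow> 'k) rb_algebra" where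
  "path_algebra k lam Y =
    \<lparr>carrier = free_module k Y,
     mult = bilinear_ext k (valley_prod k lam),
     one = basis k [],
     zero = (\<lambda>_. \<zero>\<^bsub>k\<^esub>),
     add = (\<lambda>u v z. u z \<oplus>\<^bsub>k\<^esub> v z),
     smult = (\<lambda>c u z. c \<otimes>\<^bsub>k\<^esub> u z),
     rb_op = linear_ext k raise\<rparr>"

definition path_gen :: "('k, 'm) ring_scheme \<Rightarrow> 'x \<Rightarrow> ('x path \<Rightarrow> 'k)" where
  "path_gen k x = basis k [Level x]"


subsection \<open>The characterizing equations of the product\<close>

lemma cut_path_append:
  assumes "c \<noteq> []" "\<And>i. 0 < i \<Longrightarrow> i < length c \<Longrightarrow> h + height (take i c) \<noteq> 0" "h + height c = 0"
  shows "cut_path d h (c @ m) = (d @ c) # cut_path [] 0 m"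
  using assms
proof (induction c arbitrary: d h)
  case Nil
  then show ?case by simp
next
  case (Cons s c)
  show ?case
  proof (cases "c = []")
    case True
    then show ?thesis using Cons.prems by (simp add: height_def)
  next
    case False
    have ne: "h + rise s \<noteq> 0"
      using Cons.prems(2)[of 1] False by (simp add: height_def)
    have "h + rise s + height (take i c) \<noteq> 0" if "0 < i" "i < length c" for i
      using Cons.prems(2)[of "Suc i"] that by (simp add: height_def add.assoc)
    moreover have "h + rise s + height c = 0"
      using Cons.prems(3) by (simp add: height_def add.assoc)
    ultimately show ?thesis
      using Cons.IH[OF False, of "h + rise s" "d @ [s]"] ne by simp
  qed
qed

lemma factors_concat:
  assumes "\<And>c. c \<in> set cs \<Longrightarrow> c \<in> motzkin_paths X \<and> indecomposable c \<and> c \<noteq> []"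
  shows "factors (concat cs) = cs"
  using assms
proof (induction cs)
  case Nil
  then show ?case by (simp add: factors_def)
next
  case (Cons c cs)
  have "factors (concat cs) = cs"
    by (rule Cons.IH) (simp add: Cons.prems)
  moreover have "c \<in> motzkin_paths X" "indecomposable c" "c \<noteq> []"
    using Cons.prems[of c] by auto
  ultimately show ?case
    using cut_path_append[of c 0 "[]" "concat cs"]
    by (simp add: factors_def indecomposable_def motzkin_paths_def)
qed

lemma factors_indecomposable:
  "\<lbrakk>c \<in> motzkin_paths X; indecomposable c; c \<noteq> []\<rbrakk> \<Longrightarrow> factors c = [c]"
  using factors_concat[of "[c]" X] by simp

lemma raise_motzkin:
  assumes "m \<in> motzkin_paths X"
  shows "raise m \<in> motzkin_paths X" "indecomposable (raise m)" "raise m \<noteq> []"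
proof -
  have take_raise: "height (take i (raise m)) = 1 + height (take (i - 1) m)"
    if "0 < i" "i < length (raise m)" for i
    using that by (cases i) (auto simp: raise_def height_def)
  have nonneg: "0 \<le> height (take j m)" for j
    using assms by (cases "j \<le> length m") (auto simp: motzkin_paths_def)
  have total: "height (raise m) = 0"
    using assms by (simp add: motzkin_paths_def raise_def height_def)
  have "0 \<le> height (take i (raise m))" if "i \<le> length (raise m)" for i
    using take_raise[of i] nonneg[of "i - 1"] total that
    by (cases "i = 0"; cases "i = length (raise m)") (auto simp: height_def)
  then show "raise m \<in> motzkin_paths X"
    using assms total by (auto simp: motzkin_paths_def raise_def)
  show "indecomposable (raise m)"
    unfolding indecomposable_def
  proof (intro allI impI)
    fix i
    assume "0 < i \<and> i < length (raise m)"
    then show "height (take i (raise m)) \<noteq> 0"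
      using take_raise[of i] nonneg[of "i - 1"] by simp
  qed
  show "raise m \<noteq> []"
    by (simp add: raise_def)
qed

lemma lower_raise [simp]: "lower (raise m) = m"
  by (simp add: lower_def raise_def)

context cring
begin

lemma linear_ext_closed:
  "(\<And>y. u y \<in> carrier R) \<Longrightarrow> linear_ext R g u z \<in> carrier R"
  by (auto simp: linear_ext_def intro!: finsum_closed)

lemma linear_ext_id:
  assumes "\<And>y. u y \<in> carrier R"
  shows "linear_ext R (\<lambda>n. n) u = u"
proof
  fix z
  have "{y \<in> supp R u. y = z} = (if u z = \<zero> then {} else {z})"
    by (auto simp: supp_def)
  then show "linear_ext R (\<lambda>n. n) u z = u z"
    using assms by (simp add: linear_ext_def finsum_insert)
qed

lemma basis_closed: "basis R y z \<in> carrier R"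
  by (simp add: basis_def)

lemma valley_prod_closed:
  assumes "lam \<in> carrier R"
  shows "valley_prod R lam m m' z \<in> carrier R"
proof (induction "length m + length m'" arbitrary: m m' z rule: less_induct)
  case less
  show ?case
  proof (cases "m = [] \<or> m' = []")
    case True
    then show ?thesis
      by (auto simp: valley_prod.simps[of R lam m m'] basis_closed)
  next
    case False
    define a where "a = last (factors m)"
    define b where "b = hd (factors m')"
    have la: "length a \<le> length m" and lb: "length b \<le> length m'"
      using False by (auto simp: a_def b_def length_last_factor length_first_factor)
    have rec: "linear_ext R raise (valley_prod R lam (lower a) b) z \<in> carrier R"
        "linear_ext R raise (valley_prod R lam a (lower b)) z \<in> carrier R"
        "linear_ext R raise (valley_prod R lam (lower a) (lower b)) z \<in> carrier R"
      if "a \<noteq> []" "b \<noteq> []" for z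
      using length_lower[OF that(1)] length_lower[OF that(2)] la lb
      by (auto intro!: linear_ext_closed less.hyps)
    show ?thesis
      using False assms rec
      by (auto simp: valley_prod.simps[of R lam m m'] Let_def basis_closed
          simp flip: a_def b_def intro!: linear_ext_closed)
  qed
qed

lemma valley_prod_trivial:
  "valley_prod R lam [] m = basis R m" "valley_prod R lam m [] = basis R m"
  by (simp_all add: valley_prod.simps)

lemma valley_prod_level:
  assumes "a \<in> motzkin_paths X" "indecomposable a" "a \<noteq> []"
    and "b \<in> motzkin_paths X" "indecomposable b" "b \<noteq> []"
    and "a = [Level x] \<or> b = [Level x]"
  shows "valley_prod R lam a b = basis R (a @ b)"
  using assms
  by (auto simp: valley_prod.simps[of R lam a b] factors_indecomposable linear_ext_id basis_closed)

lemma valley_prod_raise: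
  fixes m m' :: "'x path"
  assumes "lam \<in> carrier R" "m \<in> motzkin_paths X" "m' \<in> motzkin_paths X"
  shows "valley_prod R lam (raise m) (raise m') =
    (\<lambda>z. linear_ext R raise (valley_prod R lam m (raise m')) z
      \<oplus> linear_ext R raise (valley_prod R lam (raise m) m') z
      \<oplus> lam \<otimes> linear_ext R raise (valley_prod R lam m m') z)"
proof -
  have hd: "hd (raise n) = Up" for n :: "'x path"
    by (simp add: raise_def)
  show ?thesis
    using raise_motzkin[OF assms(2)] raise_motzkin[OF assms(3)] assms(1)
    by (simp add: valley_prod.simps[of R lam "raise m" "raise m'"] Let_def
        factors_indecomposable hd linear_ext_id linear_ext_closed valley_prod_closed)
qed

lemma valley_prod_factors:
  assumes "lam \<in> carrier R"
    and cs: "\<And>c. c \<in> set (ms @ [a]) \<union> set (b # ms') \<Longrightarrow>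
      c \<in> motzkin_paths X \<and> indecomposable c \<and> c \<noteq> []"
  shows "valley_prod R lam (concat ms @ a) (b @ concat ms') =
    linear_ext R (\<lambda>n. concat ms @ n @ concat ms') (valley_prod R lam a b)"
proof -
  have "factors (concat (ms @ [a])) = ms @ [a]"
    by (rule factors_concat[of _ X]) (use cs in blast)
  then have 1: "factors (concat ms @ a) = ms @ [a]"
    by simp
  have "factors (concat (b # ms')) = b # ms'"
    by (rule factors_concat[of _ X]) (use cs in blast)
  then have 2: "factors (b @ concat ms') = b # ms'"
    by simp
  have ab: "factors a = [a]" "factors b = [b]" "a \<noteq> []" "b \<noteq> []"
    using cs by (auto intro: factors_indecomposable[of _ X])
  show ?thesis
    using ab assms(1)
    by (auto simp: valley_prod.simps[of R lam "concat ms @ a" "b @ concat ms'"]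
        valley_prod.simps[of R lam a b] 1 2
        Let_def linear_ext_id basis_closed linear_ext_closed valley_prod_closed)
qed

end

end

theory Submission
  imports Defs
begin

text \<open>
  The Rota--Baxter identity rewrites a product of two operator values as a sum of operator values.
  So a morphism out of the free algebra is known once it is known on expressions in which no two
  operator values are multiplied. Reading the operator as raising and the multiplication as linking,
  such expressions are the valley-free Motzkin paths, and peaks occur only if the operator
  is applied to the unit. The product of the statement performs the rewriting.

  It is convenient to allow valleys as long as possible. On the span of all Motzkin paths the
  product still makes sense, and two facts do not depend on the absence of valleys.

  First, the product is associative and satisfies the Rota--Baxter identity (\<open>product_assoc\<close>,
  \<open>product_op\<close>). Of two paths, only the last factor of the left one and the first
  factor of the right one interact, which is expressed by the compatibility of the product with
  the link product (\<open>link_product\<close>, \<open>product_link\<close>). This reduces associativity to three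
  irreducible paths. A level step merely links, and for three raised paths both
  bracketings expand to the same seven terms by induction on the length (\<open>product_assoc_op\<close>).

  Second, a path can be evaluated in every Rota--Baxter algebra by reading its level steps as given
  elements, raising as the operator and linking as multiplication. The linear
  extension of this evaluation respects the product, because the defining recursion of
  the product is the Rota--Baxter identity, which the target satisfies as well
  (\<open>hom_product_basis\<close>). If the target has no unit, the trivial path cannot be evaluated, and
  one has to exclude the paths that contain it, that is, the trivial path and the paths with peaks.

  Valleys are excluded for the sake of uniqueness. The valley-free paths span a subalgebra closed
  under the operator (\<open>rota_baxter_path_class\<close>), and each of them arises from level steps and the
  trivial path by raising and by links that create no valley; such links are products (\<open>product_no_valley\<close>). Hence a morphism
  is determined by its values on the generators (\<open>hom_unique\<close>).
\<close>


section \<open>Motzkin paths and their factors\<close>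

lemma height_simps [simp]:
  "height [] = 0" "height (s # m) = rise s + height m" "height (m @ n) = height m + height n"
  by (simp_all add: height_def)

lemma height_take_nonneg:
  assumes "m \<in> motzkin_paths X"
  shows "0 \<le> height (take i m)"
  using assms by (cases "i \<le> length m") (auto simp: motzkin_paths_def)

lemma height_motzkin: "m \<in> motzkin_paths X \<Longrightarrow> height m = 0"
  by (simp add: motzkin_paths_def)

lemma motzkin_Nil [simp]: "[] \<in> motzkin_paths X"
  by (simp add: motzkin_paths_def)

lemma motzkin_Level [simp]: "[Level x] \<in> motzkin_paths X \<longleftrightarrow> x \<in> X"
proof -
  have "0 \<le> height (take i [Level x])" for i :: nat
    by (cases i) auto
  then show ?thesis
    unfolding motzkin_paths_def by simp
qed

lemma motzkin_append:
  assumes "m \<in> motzkin_paths X" "n \<in> motzkin_paths X"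
  shows "m @ n \<in> motzkin_paths X"
  using assms height_take_nonneg[OF assms(1)] height_take_nonneg[OF assms(2)]
  by (auto simp: motzkin_paths_def)

lemma motzkin_split:
  assumes "m @ n \<in> motzkin_paths X" "height m = 0"
  shows "m \<in> motzkin_paths X" "n \<in> motzkin_paths X"
proof -
  have "0 \<le> height (take i m)" if "i \<le> length m" for i
    using height_take_nonneg[OF assms(1), of i] that by simp
  moreover have "0 \<le> height (take i n)" for i
    using height_take_nonneg[OF assms(1), of "length m + i"] assms(2) by simp
  moreover have "height n = 0"
    using height_motzkin[OF assms(1)] assms(2) by simp
  ultimately show "m \<in> motzkin_paths X" "n \<in> motzkin_paths X"
    using assms by (auto simp: motzkin_paths_def)
qed

lemma motzkin_hd:
  assumes "m \<in> motzkin_paths X" "m \<noteq> []"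
  shows "hd m \<noteq> Down"
  using height_take_nonneg[OF assms(1), of 1] assms(2) by (cases m) auto

lemma motzkin_last:
  assumes "m \<in> motzkin_paths X" "m \<noteq> []"
  shows "last m \<noteq> Up"
  using height_take_nonneg[OF assms(1), of "length m - 1"] height_motzkin[OF assms(1)] assms(2)
  by (cases m rule: rev_cases) auto

definition irreducible_paths :: "'x set \<Rightarrow> 'x path set" where
  "irreducible_paths X = {c \<in> motzkin_paths X. indecomposable c \<and> c \<noteq> []}"

lemma irreducible_motzkin: "c \<in> irreducible_paths X \<Longrightarrow> c \<in> motzkin_paths X"
  and irreducible_not_Nil: "c \<in> irreducible_paths X \<Longrightarrow> c \<noteq> []"
  by (auto simp: irreducible_paths_def)

lemma irreducible_raise: "m \<in> motzkin_paths X \<Longrightarrow> raise m \<in> irreducible_paths X"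
  using raise_motzkin[of m X] by (simp add: irreducible_paths_def)

text \<open>
  A path that leaves the axis with an up step and returns to it only at its end returns with a
  down step, and in between it stays at height at least one.
\<close>

lemma irreducible_cases:
  assumes "c \<in> irreducible_paths X"
  obtains (level) x where "x \<in> X" "c = [Level x]"
    | (raise) m where "m \<in> motzkin_paths X" "c = raise m"
proof -
  have c: "c \<in> motzkin_paths X" "c \<noteq> []"
    and pos: "\<And>i. 0 < i \<Longrightarrow> i < length c \<Longrightarrow> 0 < height (take i c)"
    using assms height_take_nonneg[of c X]
    by (fastforce simp: irreducible_paths_def indecomposable_def order.order_iff_strict)+
  obtain s m where sm: "c = s # m"
    using c(2) by (cases c) auto
  show thesis
  proof (cases s)
    case Down
    then show thesis using motzkin_hd[OF c] sm by simp
  next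
    case (Level x)
    have "m = []"
      using pos[of 1] sm Level by (cases m) auto
    then show thesis
      using level c(1) sm Level by auto
  next
    case Up
    have "m \<noteq> []"
      using height_motzkin[OF c(1)] sm Up by auto
    then obtain n t where nt: "m = n @ [t]"
      by (cases m rule: rev_cases) auto
    have "0 < height (Up # n)"
      using pos[of "Suc (length n)"] sm nt Up by simp
    then have "t = Down" "height n = 0"
      using height_motzkin[OF c(1)] sm nt Up by (cases t; simp)+
    moreover have "0 \<le> height (take i n)" if "i \<le> length n" for i
      using pos[of "Suc i"] sm nt Up that by simp
    ultimately have "n \<in> motzkin_paths X" "c = raise n"
      using c(1) sm nt Up by (auto simp: motzkin_paths_def raise_def)
    then show thesis by (rule raise)
  qed
qed

text \<open>The first factor ends at the first return to the axis.\<close>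

lemma split_first_factor:
  assumes "m \<in> motzkin_paths X" "m \<noteq> []"
  obtains c n where "m = c @ n" "c \<in> irreducible_paths X" "n \<in> motzkin_paths X"
proof -
  define P where "P i \<longleftrightarrow> 0 < i \<and> i \<le> length m \<and> height (take i m) = 0" for i
  define i where "i = (LEAST i. P i)"
  have "P (length m)"
    using assms height_motzkin[OF assms(1)] by (simp add: P_def)
  then have i: "P i"
    unfolding i_def by (rule LeastI)
  have least: "i \<le> j" if "P j" for j
    unfolding i_def using that by (rule Least_le)
  have mot: "take i m \<in> motzkin_paths X" "drop i m \<in> motzkin_paths X"
    using motzkin_split[of "take i m" "drop i m" X] assms i by (auto simp: P_def)
  have "height (take j (take i m)) \<noteq> 0" if "0 < j" "j < i" for j
    using least[of j] that i by (auto simp: P_def)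
  then have "take i m \<in> irreducible_paths X"
    using mot i by (auto simp: irreducible_paths_def indecomposable_def P_def)
  then show thesis
    using that[of "take i m" "drop i m"] mot by simp
qed

lemma motzkin_concat_irreducible:
  assumes "m \<in> motzkin_paths X"
  obtains cs where "m = concat cs" "set cs \<subseteq> irreducible_paths X"
  using assms
proof (induction "length m" arbitrary: m thesis rule: less_induct)
  case less
  show ?case
  proof (cases "m = []")
    case True
    then show ?thesis using less.prems(1)[of "[]"] by simp
  next
    case False
    then obtain c n where cn: "m = c @ n" "c \<in> irreducible_paths X" "n \<in> motzkin_paths X"
      using split_first_factor less.prems(2) by blast
    then obtain cs where "n = concat cs" "set cs \<subseteq> irreducible_paths X"
      using less.hyps[of n] irreducible_not_Nil[of c X] by auto
    then show ?thesis
      using less.prems(1)[of "c # cs"] cn by simp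
  qed
qed

lemma factors_concat_irreducible:
  "set cs \<subseteq> irreducible_paths X \<Longrightarrow> factors (concat cs) = cs"
  by (rule factors_concat[of cs X]) (auto simp: irreducible_paths_def)

lemma factors_append:
  assumes "m \<in> motzkin_paths X" "n \<in> motzkin_paths X"
  shows "factors (m @ n) = factors m @ factors n"
proof -
  obtain cs ds where "m = concat cs" "set cs \<subseteq> irreducible_paths X"
    "n = concat ds" "set ds \<subseteq> irreducible_paths X"
    using motzkin_concat_irreducible assms by metis
  then show ?thesis
    using factors_concat_irreducible[of "cs @ ds" X] by (simp add: factors_concat_irreducible)
qed

lemma factors_irreducible: "c \<in> irreducible_paths X \<Longrightarrow> factors c = [c]"
  using factors_concat_irreducible[of "[c]" X] by simp

lemma split_last_factor:
  assumes "m \<in> motzkin_paths X" "m \<noteq> []"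
  obtains n c where "m = n @ c" "n \<in> motzkin_paths X" "c \<in> irreducible_paths X"
proof -
  obtain cs where cs: "m = concat cs" "set cs \<subseteq> irreducible_paths X"
    using motzkin_concat_irreducible assms(1) by blast
  with assms(2) obtain ds c where ds: "cs = ds @ [c]"
    by (cases cs rule: rev_cases) auto
  have "concat ds \<in> motzkin_paths X"
    using cs(2) unfolding ds by (induction ds) (auto intro: motzkin_append irreducible_motzkin)
  then show thesis
    using that[of "concat ds" c] cs ds by simp
qed


section \<open>Valley-free and peak-free paths\<close>

text \<open>
  Whether valleys, resp. peaks together with the trivial path, are excluded is controlled by two
  flags, so that all Motzkin paths, the valley-free paths and the valley- and peak-free paths
  are members of a single family.
\<close>

definition path_class :: "'x set \<Rightarrow> bool \<Rightarrow> bool \<Rightarrow> 'x path set" where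
  "path_class X vf pf = {m \<in> motzkin_paths X.
    (vf \<longrightarrow> successively (\<lambda>s t. \<not> (s = Down \<and> t = Up)) m) \<and>
    (pf \<longrightarrow> m \<noteq> [] \<and> successively (\<lambda>s t. \<not> (s = Up \<and> t = Down)) m)}"

lemma successively_avoids_iff:
  "successively (\<lambda>s t. \<not> (s = p \<and> t = q)) m \<longleftrightarrow> \<not> (\<exists>a b. m = a @ [p, q] @ b)"
proof (induction m)
  case Nil
  then show ?case by simp
next
  case (Cons s m)
  have "(\<exists>a b. s # m = a @ [p, q] @ b) \<longleftrightarrow>
      (\<exists>b. s # m = [p, q] @ b) \<or> (\<exists>a b. m = a @ [p, q] @ b)"
    by (auto simp: Cons_eq_append_conv)
  moreover have "(\<exists>b. s # m = [p, q] @ b) \<longleftrightarrow> m \<noteq> [] \<and> s = p \<and> hd m = q"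
    by (cases m) auto
  ultimately show ?case
    using Cons.IH by (auto simp: successively_Cons)
qed

lemma path_class_motzkin: "path_class X False False = motzkin_paths X"
  and path_class_valley_free: "path_class X True False = valley_free_paths X"
  and path_class_valley_peak_free:
    "path_class X True True = valley_free_paths X \<inter> peak_free_paths X"
  unfolding path_class_def valley_free_paths_def peak_free_paths_def successively_avoids_iff
  by blast+

lemma path_class_subset: "path_class X vf pf \<subseteq> motzkin_paths X"
  and path_class_allow_valleys: "path_class X vf pf \<subseteq> path_class X False pf"
  by (auto simp: path_class_def)

lemma path_class_Nil [simp]: "[] \<in> path_class X vf pf \<longleftrightarrow> \<not> pf"
  by (simp add: path_class_def)

lemma path_class_Level: "x \<in> X \<Longrightarrow> [Level x] \<in> path_class X vf pf"
  by (simp add: path_class_def)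

text \<open>A peak can only be created when the trivial path is raised.\<close>

lemma path_class_raise:
  assumes "m \<in> motzkin_paths X"
  shows "raise m \<in> path_class X vf pf \<longleftrightarrow> m \<in> path_class X vf pf"
  using assms raise_motzkin[OF assms] motzkin_hd[OF assms] motzkin_last[OF assms]
  by (cases "m = []")
    (auto simp: path_class_def raise_def successively_append_iff successively_Cons)

lemma path_class_append:
  assumes "m \<in> path_class X vf pf" "n \<in> path_class X vf pf"
    and "\<not> (m \<noteq> [] \<and> n \<noteq> [] \<and> last m = Down \<and> hd n = Up)"
  shows "m @ n \<in> path_class X vf pf"
  using assms motzkin_append[of m X n] motzkin_last[of m X]
  by (auto simp: path_class_def successively_append_iff)

text \<open>Linking can create a valley, but no peak.\<close>

lemma path_class_append_valley:
  assumes "m \<in> path_class X False pf" "n \<in> path_class X False pf"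
  shows "m @ n \<in> path_class X False pf"
  using assms motzkin_append[of m X n] motzkin_last[of m X]
  by (auto simp: path_class_def successively_append_iff)

lemma path_class_appendD:
  assumes "m @ n \<in> path_class X vf pf" "m \<in> motzkin_paths X" "n \<in> motzkin_paths X"
  shows "m \<noteq> [] \<Longrightarrow> m \<in> path_class X vf pf" "n \<noteq> [] \<Longrightarrow> n \<in> path_class X vf pf"
  using assms by (auto simp: path_class_def successively_append_iff)

text \<open>All raised paths begin with an up step and end with a down step, so exchanging one for
  another creates neither a valley nor a peak at its two ends.\<close>

lemma path_class_replace:
  assumes "m @ raise q \<in> path_class X vf pf" "raise q' @ n \<in> path_class X vf pf"
    and "m \<in> motzkin_paths X" "n \<in> motzkin_paths X" "r \<in> path_class X vf pf"
  shows "m @ raise r @ n \<in> path_class X vf pf"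
proof -
  have r: "r \<in> motzkin_paths X"
    using assms(5) path_class_subset by blast
  then have "raise r \<in> path_class X vf pf"
    using assms(5) by (simp add: path_class_raise)
  moreover have "m @ raise r @ n \<in> motzkin_paths X"
    using assms r by (intro motzkin_append raise_motzkin)
  moreover have "raise p \<noteq> []" "hd (raise p) = Up" "last (raise p) = Down" for p :: "'a path"
    by (auto simp: raise_def)
  ultimately show ?thesis
    using assms(1,2) motzkin_last[OF assms(3)] unfolding path_class_def
    by (auto simp: successively_append_iff hd_append last_append)
qed

text \<open>
  Induction along which a valley-free path is built from shorter ones without ever linking
  two raised paths.
\<close>

lemma valley_free_induct [consumes 1, case_names trivial level raise link]:
  assumes "m \<in> path_class X True pf"
    and "\<not> pf \<Longrightarrow> P []"
    and "\<And>x. x \<in> X \<Longrightarrow> P [Level x]"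
    and "\<And>m. m \<in> path_class X True pf \<Longrightarrow> P m \<Longrightarrow> P (raise m)"
    and "\<And>m n. \<lbrakk>m \<in> path_class X True pf; n \<in> path_class X True pf; m \<noteq> []; n \<noteq> [];
        \<not> (last m = Down \<and> hd n = Up); P m; P n\<rbrakk> \<Longrightarrow> P (m @ n)"
  shows "P m"
  using assms(1)
proof (induction "length m" arbitrary: m rule: less_induct)
  case less
  have m: "m \<in> motzkin_paths X"
    using less.prems path_class_subset by blast
  show ?case
  proof (cases "m = []")
    case True
    then show ?thesis using assms(2) less.prems by (auto simp: path_class_def)
  next
    case False
    then obtain c n where cn: "m = c @ n" "c \<in> irreducible_paths X" "n \<in> motzkin_paths X"
      using split_first_factor m by blast
    have c: "c \<in> motzkin_paths X" "c \<noteq> []"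
      using cn(2) by (auto simp: irreducible_paths_def)
    show ?thesis
    proof (cases "n = []")
      case True
      from cn(2) show ?thesis
      proof (cases rule: irreducible_cases)
        case (level x)
        then show ?thesis using assms(3) cn True by simp
      next
        case (raise q)
        then have "q \<in> path_class X True pf"
          using less.prems cn True by (simp add: path_class_raise)
        then show ?thesis
          using assms(4) less.hyps[of q] cn True raise by (simp add: raise_def)
      qed
    next
      case False
      have cls: "c \<in> path_class X True pf" "n \<in> path_class X True pf"
        using path_class_appendD[of c n] less.prems cn c False by auto
      moreover have "\<not> (last c = Down \<and> hd n = Up)"
        using less.prems cn(1) c False by (auto simp: path_class_def successively_append_iff)
      moreover have "P c" "P n"
        using cls less.hyps cn c False by auto
      ultimately show ?thesis
        using assms(5) cn(1) c False by blast
    qed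
  qed
qed


section \<open>Linear and bilinear maps on free modules\<close>

definition vec_add :: "('k, 'm) ring_scheme \<Rightarrow> ('y \<Rightarrow> 'k) \<Rightarrow> ('y \<Rightarrow> 'k) \<Rightarrow> 'y \<Rightarrow> 'k" where
  "vec_add k u v = (\<lambda>z. u z \<oplus>\<^bsub>k\<^esub> v z)"

definition vec_scale :: "('k, 'm) ring_scheme \<Rightarrow> 'k \<Rightarrow> ('y \<Rightarrow> 'k) \<Rightarrow> 'y \<Rightarrow> 'k" where
  "vec_scale k c u = (\<lambda>z. c \<otimes>\<^bsub>k\<^esub> u z)"

definition linear_map ::
  "('k, 'm) ring_scheme \<Rightarrow> 'y set \<Rightarrow> ('k, 'a, 'n) module_scheme \<Rightarrow> (('y \<Rightarrow> 'k) \<Rightarrow> 'a) \<Rightarrow> bool" where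
  "linear_map k Y N h \<longleftrightarrow> h \<in> free_module k Y \<rightarrow> carrier N \<and>
    (\<forall>u\<in>free_module k Y. \<forall>v\<in>free_module k Y. h (vec_add k u v) = h u \<oplus>\<^bsub>N\<^esub> h v) \<and>
    (\<forall>c\<in>carrier k. \<forall>u\<in>free_module k Y. h (vec_scale k c u) = c \<odot>\<^bsub>N\<^esub> h u)"

definition lin_comb ::
  "('k, 'm) ring_scheme \<Rightarrow> ('k, 'a, 'n) module_scheme \<Rightarrow> ('y \<Rightarrow> 'a) \<Rightarrow> ('y \<Rightarrow> 'k) \<Rightarrow> 'a" where
  "lin_comb k N g u = finsum N (\<lambda>y. u y \<odot>\<^bsub>N\<^esub> g y) (supp k u)"

lemma path_algebra_simps [simp]:
  "carrier (path_algebra k lam Y) = free_module k Y"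
  "mult (path_algebra k lam Y) = bilinear_ext k (valley_prod k lam)"
  "one (path_algebra k lam Y) = basis k []"
  "zero (path_algebra k lam Y) = (\<lambda>_. \<zero>\<^bsub>k\<^esub>)"
  "add (path_algebra k lam Y) = vec_add k"
  "smult (path_algebra k lam Y) = vec_scale k"
  "rb_op (path_algebra k lam Y) = linear_ext k raise"
  by (simp_all add: path_algebra_def vec_add_def vec_scale_def fun_eq_iff)

context cring
begin

lemma free_moduleD:
  assumes "u \<in> free_module R Y"
  shows "u y \<in> carrier R" "finite (supp R u)" "supp R u \<subseteq> Y"
  using assms by (auto simp: free_module_def)

lemma free_moduleI:
  assumes "\<And>y. u y \<in> carrier R" "finite Y'" "\<And>y. y \<notin> Y' \<Longrightarrow> u y = \<zero>" "Y' \<subseteq> Y"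
  shows "u \<in> free_module R Y"
proof -
  have "supp R u \<subseteq> Y'"
    using assms(3) by (auto simp: supp_def)
  then show ?thesis
    using assms by (auto simp: free_module_def intro: finite_subset)
qed

lemma free_module_mono: "Y \<subseteq> Z \<Longrightarrow> u \<in> free_module R Y \<Longrightarrow> u \<in> free_module R Z"
  by (auto simp: free_module_def)

lemma free_module_UNIV [simp]: "u \<in> free_module R Y \<Longrightarrow> u \<in> free_module R UNIV"
  by (auto simp: free_module_def)

lemma zero_free_module [simp]: "(\<lambda>_. \<zero>) \<in> free_module R Y"
  by (rule free_moduleI[of _ "{}"]) auto

lemma basis_free_module [simp]: "y \<in> Y \<Longrightarrow> basis R y \<in> free_module R Y"
  by (rule free_moduleI[of _ "{y}"]) (auto simp: basis_def)

lemma supp_basis: "z \<in> supp R (basis R y) \<Longrightarrow> z = y"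
  by (auto simp: supp_def basis_def split: if_splits)

lemma vec_add_free_module [simp]:
  assumes "u \<in> free_module R Y" "v \<in> free_module R Y"
  shows "vec_add R u v \<in> free_module R Y"
  using free_moduleD[OF assms(1)] free_moduleD[OF assms(2)]
  by (intro free_moduleI[of _ "supp R u \<union> supp R v"]) (auto simp: vec_add_def supp_def)

lemma vec_scale_free_module [simp]:
  assumes "c \<in> carrier R" "u \<in> free_module R Y"
  shows "vec_scale R c u \<in> free_module R Y"
  using free_moduleD[OF assms(2)] assms(1)
  by (intro free_moduleI[of _ "supp R u"]) (auto simp: vec_scale_def supp_def)

lemma vec_add_null:
  assumes "u \<in> free_module R Y"
  shows "vec_add R (\<lambda>_. \<zero>) u = u"
  using free_moduleD(1)[OF assms] by (simp add: vec_add_def)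

lemma vec_ac:
  assumes "u \<in> free_module R UNIV" "v \<in> free_module R UNIV"
  shows "vec_add R u v = vec_add R v u"
    and "w \<in> free_module R UNIV \<Longrightarrow> vec_add R (vec_add R u v) w = vec_add R u (vec_add R v w)"
    and "w \<in> free_module R UNIV \<Longrightarrow> vec_add R u (vec_add R v w) = vec_add R v (vec_add R u w)"
  using free_moduleD(1)[OF assms(1)] free_moduleD(1)[OF assms(2)] free_moduleD(1)[of w UNIV]
  by (auto simp: vec_add_def a_ac)

lemma vec_scale_add:
  assumes "c \<in> carrier R" "u \<in> free_module R UNIV" "v \<in> free_module R UNIV"
  shows "vec_scale R c (vec_add R u v) = vec_add R (vec_scale R c u) (vec_scale R c v)"
  using assms(1) free_moduleD(1)[OF assms(2)] free_moduleD(1)[OF assms(3)]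
  by (auto simp: vec_add_def vec_scale_def r_distr)

lemma vec_scale_commute:
  assumes "c \<in> carrier R" "d \<in> carrier R" "u \<in> free_module R UNIV"
  shows "vec_scale R c (vec_scale R d u) = vec_scale R d (vec_scale R c u)"
  using assms(1,2) free_moduleD(1)[OF assms(3)] by (auto simp: vec_scale_def m_lcomm)

lemma module_path_algebra: "module R (path_algebra R lam Y)"
proof (rule moduleI[OF is_cring])
  show "abelian_group (path_algebra R lam Y)"
  proof (rule abelian_groupI, goal_cases)
    case (6 u)
    then have "vec_scale R (\<ominus> \<one>) u \<in> free_module R Y"
      by simp
    moreover have "\<ominus> \<one> \<otimes> u z \<oplus> u z = \<zero>" for z
      using 6 free_moduleD(1)[of u Y] by (simp add: l_minus l_neg)
    then have "vec_add R (vec_scale R (\<ominus> \<one>) u) u = (\<lambda>_. \<zero>)"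
      by (simp add: vec_add_def vec_scale_def)
    ultimately show ?case by auto
  qed (auto simp: vec_add_null, auto simp: vec_add_def free_moduleD a_ac)
qed (auto, auto simp: vec_scale_def vec_add_def free_moduleD l_distr r_distr m_assoc)

lemma free_module_induct [consumes 1, case_names zero add]:
  assumes "u \<in> free_module R Y"
    and zero: "P (\<lambda>_. \<zero>)"
    and add: "\<And>c y v. c \<in> carrier R \<Longrightarrow> y \<in> Y \<Longrightarrow> v \<in> free_module R Y \<Longrightarrow> P v \<Longrightarrow>
      P (vec_add R (vec_scale R c (basis R y)) v)"
  shows "P u"
proof -
  have "P u" if "finite S" "u \<in> free_module R Y" "supp R u \<subseteq> S" for S u
    using that
  proof (induction S arbitrary: u)
    case empty
    then have "u = (\<lambda>_. \<zero>)"
      by (auto simp: supp_def)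
    then show ?case using zero by simp
  next
    case (insert y S)
    note u = free_moduleD[OF insert.prems(1)]
    let ?v = "u(y := \<zero>)"
    have v: "?v \<in> free_module R Y"
      using u by (intro free_moduleI[of _ "supp R u"]) (auto simp: supp_def)
    have Pv: "P ?v"
      using insert.prems by (intro insert.IH v) (auto simp: supp_def)
    have eq: "u = vec_add R (vec_scale R (u y) (basis R y)) ?v"
      using u(1) by (auto simp: vec_add_def vec_scale_def basis_def)
    show ?case
    proof (cases "y \<in> Y")
      case True
      then show ?thesis
        using add[OF u(1) True v Pv] eq by metis
    next
      case False
      then have "u = ?v"
        using u(3) by (auto simp: supp_def fun_eq_iff)
      then show ?thesis using Pv by metis
    qed
  qed
  then show ?thesis
    using assms(1) free_moduleD(2) by blast
qed

lemma linear_map_eqI: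
  assumes "module R N" "linear_map R Y N f" "linear_map R Y N g"
    and "\<And>y. y \<in> Y \<Longrightarrow> f (basis R y) = g (basis R y)"
    and "u \<in> free_module R Y"
  shows "f u = g u"
proof -
  interpret N: module R N by fact
  have null: "h (\<lambda>_. \<zero>) = \<zero>\<^bsub>N\<^esub>" if "linear_map R Y N h" for h
  proof -
    have "(\<lambda>_. \<zero>) = vec_scale R \<zero> (\<lambda>_. \<zero>)"
      by (simp add: vec_scale_def)
    then have "h (\<lambda>_. \<zero>) = \<zero> \<odot>\<^bsub>N\<^esub> h (\<lambda>_. \<zero>)"
      using that zero_closed zero_free_module unfolding linear_map_def by metis
    moreover have "h (\<lambda>_. \<zero>) \<in> carrier N"
      using that by (auto simp: linear_map_def)
    ultimately show ?thesis by simp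
  qed
  show ?thesis
    using assms(5)
  proof (induction rule: free_module_induct)
    case zero
    show ?case using null[OF assms(2)] null[OF assms(3)] by simp
  next
    case (add c y v)
    then show ?case
      using assms(2-4) by (simp add: linear_map_def)
  qed
qed

text \<open>
  The supports of \<open>u\<close>, \<open>v\<close> and \<open>u + v\<close> differ. To compare sums over them, all sums are taken
  over a common finite superset; this is the purpose of the three lemmas named \<open>eq_sum\<close>.
\<close>

lemma lin_comb_eq_sum:
  assumes "module R N" "u \<in> free_module R Y" "g \<in> Y \<rightarrow> carrier N"
    and "finite S" "supp R u \<subseteq> S" "S \<subseteq> Y"
  shows "lin_comb R N g u = finsum N (\<lambda>y. u y \<odot>\<^bsub>N\<^esub> g y) S"
proof -
  interpret N: module R N by fact
  show ?thesis
    unfolding lin_comb_def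
    by (rule N.add.finprod_mono_neutral_cong_left)
      (use assms free_moduleD[OF assms(2)] in \<open>auto simp: supp_def Pi_iff subset_iff\<close>)
qed

lemma lin_comb_basis:
  assumes "module R N" "g \<in> Y \<rightarrow> carrier N" "y \<in> Y"
  shows "lin_comb R N g (basis R y) = g y"
proof -
  interpret N: module R N by fact
  have "g y \<in> carrier N"
    using assms by auto
  moreover have "lin_comb R N g (basis R y) = finsum N (\<lambda>z. basis R y z \<odot>\<^bsub>N\<^esub> g z) {y}"
    using assms by (intro lin_comb_eq_sum[of N _ Y]) (auto dest: supp_basis)
  ultimately show ?thesis
    by (simp add: basis_def)
qed

lemma linear_map_lin_comb:
  assumes "module R N" "g \<in> Y \<rightarrow> carrier N"
  shows "linear_map R Y N (lin_comb R N g)"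
proof -
  interpret N: module R N by fact
  have gN: "y \<in> Y \<Longrightarrow> g y \<in> carrier N" for y
    using assms(2) by auto
  have "lin_comb R N g u \<in> carrier N" if "u \<in> free_module R Y" for u
    using free_moduleD[OF that] gN unfolding lin_comb_def
    by (intro N.finsum_closed) (auto simp: subset_iff)
  moreover have "lin_comb R N g (vec_add R u v) = lin_comb R N g u \<oplus>\<^bsub>N\<^esub> lin_comb R N g v"
    if uv: "u \<in> free_module R Y" "v \<in> free_module R Y" for u v
  proof -
    note u = free_moduleD[OF uv(1)] and v = free_moduleD[OF uv(2)]
    let ?S = "supp R u \<union> supp R v"
    have S: "finite ?S" "supp R u \<subseteq> ?S" "supp R v \<subseteq> ?S" "supp R (vec_add R u v) \<subseteq> ?S" "?S \<subseteq> Y"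
      using u v by (auto simp: supp_def vec_add_def)
    have Sg: "y \<in> ?S \<Longrightarrow> g y \<in> carrier N" for y
      using S(5) gN by blast
    have "finsum N (\<lambda>y. vec_add R u v y \<odot>\<^bsub>N\<^esub> g y) ?S
        = finsum N (\<lambda>y. u y \<odot>\<^bsub>N\<^esub> g y \<oplus>\<^bsub>N\<^esub> v y \<odot>\<^bsub>N\<^esub> g y) ?S"
      using u v Sg by (intro N.finsum_cong') (auto simp: vec_add_def N.smult_l_distr)
    also have "\<dots> = finsum N (\<lambda>y. u y \<odot>\<^bsub>N\<^esub> g y) ?S \<oplus>\<^bsub>N\<^esub> finsum N (\<lambda>y. v y \<odot>\<^bsub>N\<^esub> g y) ?S"
      using u v Sg by (intro N.finsum_addf) auto
    finally show ?thesis
      using uv S by (simp add: lin_comb_eq_sum[OF assms(1) _ assms(2) S(1) _ S(5)])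
  qed
  moreover have "lin_comb R N g (vec_scale R c u) = c \<odot>\<^bsub>N\<^esub> lin_comb R N g u"
    if cu: "c \<in> carrier R" "u \<in> free_module R Y" for c u
  proof -
    note u = free_moduleD[OF cu(2)]
    have S: "supp R (vec_scale R c u) \<subseteq> supp R u"
      using cu(1) by (auto simp: supp_def vec_scale_def)
    have Sg: "y \<in> supp R u \<Longrightarrow> g y \<in> carrier N" for y
      using u(3) gN by blast
    have "c \<odot>\<^bsub>N\<^esub> lin_comb R N g u = finsum N (\<lambda>y. c \<odot>\<^bsub>N\<^esub> (u y \<odot>\<^bsub>N\<^esub> g y)) (supp R u)"
      unfolding lin_comb_def using u Sg cu by (intro N.finsum_smult_ldistr) auto
    also have "\<dots> = finsum N (\<lambda>y. vec_scale R c u y \<odot>\<^bsub>N\<^esub> g y) (supp R u)"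
      using u cu Sg by (intro N.finsum_cong') (auto simp: vec_scale_def N.smult_assoc1)
    finally show ?thesis
      using cu u S by (simp add: lin_comb_eq_sum[OF assms(1) _ assms(2) u(2) S u(3)])
  qed
  ultimately show ?thesis
    by (auto simp: linear_map_def)
qed

lemma linear_ext_eq_sum:
  assumes "u \<in> free_module R Y" "finite S" "supp R u \<subseteq> S"
  shows "linear_ext R g u z = (\<Oplus>y\<in>S. if g y = z then u y else \<zero>)"
  unfolding linear_ext_def
  by (rule add.finprod_mono_neutral_cong_left)
    (use assms free_moduleD[OF assms(1)] in \<open>auto simp: supp_def\<close>)

lemma linear_ext_free_module:
  assumes "u \<in> free_module R Y" "\<And>y. y \<in> Y \<Longrightarrow> g y \<in> Z"
  shows "linear_ext R g u \<in> free_module R Z"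
proof (rule free_moduleI)
  note u = free_moduleD[OF assms(1)]
  show "linear_ext R g u z \<in> carrier R" for z
    using u(1) by (rule linear_ext_closed)
  show "finite (g ` supp R u)" "g ` supp R u \<subseteq> Z"
    using u assms(2) by auto
  show "linear_ext R g u z = \<zero>" if "z \<notin> g ` supp R u" for z
  proof -
    have "{y \<in> supp R u. g y = z} = {}"
      using that by auto
    then show ?thesis by (simp only: linear_ext_def finsum_empty)
  qed
qed

lemma linear_ext_UNIV [simp]:
  "u \<in> free_module R UNIV \<Longrightarrow> linear_ext R g u \<in> free_module R UNIV"
  by (rule linear_ext_free_module) auto

lemma linear_ext_basis [simp]: "linear_ext R g (basis R y) = basis R (g y)"
proof
  fix z
  show "linear_ext R g (basis R y) z = basis R (g y) z"
  proof -
    have "linear_ext R g (basis R y) z = (\<Oplus>w\<in>{y}. if g w = z then basis R y w else \<zero>)"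
      by (intro linear_ext_eq_sum[of _ UNIV]) (auto dest: supp_basis)
    then show ?thesis
      by (auto simp: basis_def)
  qed
qed

lemma linear_ext_add [simp]:
  assumes uv: "u \<in> free_module R UNIV" "v \<in> free_module R UNIV"
  shows "linear_ext R g (vec_add R u v) = vec_add R (linear_ext R g u) (linear_ext R g v)"
proof
  fix z
  note u = free_moduleD[OF uv(1)] and v = free_moduleD[OF uv(2)]
  let ?S = "supp R u \<union> supp R v"
  have S: "finite ?S" "supp R u \<subseteq> ?S" "supp R v \<subseteq> ?S" "supp R (vec_add R u v) \<subseteq> ?S"
    using u v by (auto simp: supp_def vec_add_def)
  have "(\<Oplus>y\<in>?S. if g y = z then vec_add R u v y else \<zero>)
      = (\<Oplus>y\<in>?S. (if g y = z then u y else \<zero>) \<oplus> (if g y = z then v y else \<zero>))"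
    using u v by (intro finsum_cong') (auto simp: vec_add_def)
  also have "\<dots> = (\<Oplus>y\<in>?S. if g y = z then u y else \<zero>) \<oplus> (\<Oplus>y\<in>?S. if g y = z then v y else \<zero>)"
    using u v by (intro finsum_addf) auto
  finally show "linear_ext R g (vec_add R u v) z
      = vec_add R (linear_ext R g u) (linear_ext R g v) z"
    using uv S by (simp add: linear_ext_eq_sum[of _ UNIV, OF _ S(1)] vec_add_def[of R "linear_ext R g u"])
qed

lemma linear_ext_scale [simp]:
  assumes cu: "c \<in> carrier R" "u \<in> free_module R UNIV"
  shows "linear_ext R g (vec_scale R c u) = vec_scale R c (linear_ext R g u)"
proof
  fix z
  note u = free_moduleD[OF cu(2)]
  have S: "supp R (vec_scale R c u) \<subseteq> supp R u"
    using cu(1) by (auto simp: supp_def vec_scale_def)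
  have "c \<otimes> (\<Oplus>y\<in>supp R u. if g y = z then u y else \<zero>)
      = (\<Oplus>y\<in>supp R u. c \<otimes> (if g y = z then u y else \<zero>))"
    using u cu by (intro finsum_rdistr) auto
  also have "\<dots> = (\<Oplus>y\<in>supp R u. if g y = z then vec_scale R c u y else \<zero>)"
    using u cu by (intro finsum_cong') (auto simp: vec_scale_def)
  finally show "linear_ext R g (vec_scale R c u) z = vec_scale R c (linear_ext R g u) z"
    using cu S by (simp add: linear_ext_eq_sum[of _ UNIV, OF _ u(2)] vec_scale_def[of R c "linear_ext R g u"])
qed

lemma bilinear_ext_eq_sum:
  assumes "\<And>y y'. B y y' \<in> free_module R UNIV"
    and "u \<in> free_module R UNIV" "finite S" "supp R u \<subseteq> S"
    and "v \<in> free_module R UNIV" "finite T" "supp R v \<subseteq> T"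
  shows "bilinear_ext R B u v z = finsum R (\<lambda>(y, y'). (u y \<otimes> v y') \<otimes> B y y' z) (S \<times> T)"
  unfolding bilinear_ext_def
  by (rule add.finprod_mono_neutral_cong_left)
    (use assms free_moduleD(1)[OF assms(1)] free_moduleD(1)[OF assms(2)] free_moduleD(1)[OF assms(5)]
      in \<open>auto simp: supp_def\<close>)

lemma bilinear_ext_free_module:
  assumes "u \<in> free_module R Y" "v \<in> free_module R Y'"
    and "\<And>y y'. y \<in> Y \<Longrightarrow> y' \<in> Y' \<Longrightarrow> B y y' \<in> free_module R Z"
  shows "bilinear_ext R B u v \<in> free_module R Z"
proof (rule free_moduleI)
  note u = free_moduleD[OF assms(1)] and v = free_moduleD[OF assms(2)]
  have B: "B y y' \<in> free_module R Z" if "y \<in> supp R u" "y' \<in> supp R v" for y y'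
    using assms(3) u v that by blast
  show "bilinear_ext R B u v z \<in> carrier R" for z
    unfolding bilinear_ext_def using u v free_moduleD(1)[OF B]
    by (intro finsum_closed) auto
  let ?S = "\<Union>(y, y')\<in>supp R u \<times> supp R v. supp R (B y y')"
  show "finite ?S" "?S \<subseteq> Z"
    using u(2) v(2) free_moduleD(2)[OF B] free_moduleD(3)[OF B]
    by (auto, metis (no_types, lifting) subsetD)
  show "bilinear_ext R B u v z = \<zero>" if "z \<notin> ?S" for z
    unfolding bilinear_ext_def
  proof (rule add.finprod_one_eqI)
    fix p assume "p \<in> supp R u \<times> supp R v"
    moreover from this that have "B (fst p) (snd p) z = \<zero>"
      by (auto simp: supp_def[of R "B _ _"])
    ultimately show "(case p of (y, y') \<Rightarrow> (u y \<otimes> v y') \<otimes> B y y' z) = \<zero>"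
      using u v by (auto simp: split_beta)
  qed
qed

lemma bilinear_ext_basis:
  assumes "\<And>y y'. B y y' \<in> free_module R UNIV"
  shows "bilinear_ext R B (basis R y) (basis R y') = B y y'"
proof
  fix z
  have "bilinear_ext R B (basis R y) (basis R y') z
      = finsum R (\<lambda>(w, w'). (basis R y w \<otimes> basis R y' w') \<otimes> B w w' z) ({y} \<times> {y'})"
    using assms by (intro bilinear_ext_eq_sum) (auto dest: supp_basis)
  then show "bilinear_ext R B (basis R y) (basis R y') z = B y y' z"
    using free_moduleD(1)[OF assms] by (simp add: basis_def)
qed

lemma bilinear_ext_add_left:
  assumes B: "\<And>y y'. B y y' \<in> free_module R UNIV"
    and uv: "u \<in> free_module R UNIV" "v \<in> free_module R UNIV" "w \<in> free_module R UNIV"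
  shows "bilinear_ext R B (vec_add R u v) w
    = vec_add R (bilinear_ext R B u w) (bilinear_ext R B v w)"
proof
  fix z
  note u = free_moduleD[OF uv(1)] and v = free_moduleD[OF uv(2)] and w = free_moduleD[OF uv(3)]
    and B' = free_moduleD(1)[OF B]
  let ?S = "supp R u \<union> supp R v" and ?T = "supp R w"
  have S: "finite ?S" "supp R u \<subseteq> ?S" "supp R v \<subseteq> ?S" "supp R (vec_add R u v) \<subseteq> ?S"
    using u v by (auto simp: supp_def vec_add_def)
  have "finsum R (\<lambda>(y, y'). (vec_add R u v y \<otimes> w y') \<otimes> B y y' z) (?S \<times> ?T)
      = (\<Oplus>p\<in>?S \<times> ?T. (case p of (y, y') \<Rightarrow> (u y \<otimes> w y') \<otimes> B y y' z) \<oplus>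
          (case p of (y, y') \<Rightarrow> (v y \<otimes> w y') \<otimes> B y y' z))"
    using u v w B' by (intro finsum_cong') (auto simp: vec_add_def l_distr)
  also have "\<dots> = finsum R (\<lambda>(y, y'). (u y \<otimes> w y') \<otimes> B y y' z) (?S \<times> ?T)
      \<oplus> finsum R (\<lambda>(y, y'). (v y \<otimes> w y') \<otimes> B y y' z) (?S \<times> ?T)"
    using u v w B' by (intro finsum_addf) auto
  finally show "bilinear_ext R B (vec_add R u v) w z
      = vec_add R (bilinear_ext R B u w) (bilinear_ext R B v w) z"
    using uv S w
    by (simp add: bilinear_ext_eq_sum[OF B _ S(1) _ _ w(2)] vec_add_def[of R "bilinear_ext R B u w"])
qed

lemma bilinear_ext_scale_left:
  assumes B: "\<And>y y'. B y y' \<in> free_module R UNIV"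
    and cu: "c \<in> carrier R" "u \<in> free_module R UNIV" "w \<in> free_module R UNIV"
  shows "bilinear_ext R B (vec_scale R c u) w = vec_scale R c (bilinear_ext R B u w)"
proof
  fix z
  note u = free_moduleD[OF cu(2)] and w = free_moduleD[OF cu(3)]
    and B' = free_moduleD(1)[OF B]
  have S: "supp R (vec_scale R c u) \<subseteq> supp R u"
    using cu(1) by (auto simp: supp_def vec_scale_def)
  let ?S = "supp R u \<times> supp R w"
  have "c \<otimes> finsum R (\<lambda>(y, y'). (u y \<otimes> w y') \<otimes> B y y' z) ?S
      = (\<Oplus>p\<in>?S. c \<otimes> (case p of (y, y') \<Rightarrow> (u y \<otimes> w y') \<otimes> B y y' z))"
    using u w cu B' by (intro finsum_rdistr) auto
  also have "\<dots> = finsum R (\<lambda>(y, y'). (vec_scale R c u y \<otimes> w y') \<otimes> B y y' z) ?S"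
    using u w cu B' by (intro finsum_cong') (auto simp: vec_scale_def m_assoc)
  finally show "bilinear_ext R B (vec_scale R c u) w z = vec_scale R c (bilinear_ext R B u w) z"
    using cu S w
    by (simp add: bilinear_ext_eq_sum[OF B _ u(2) _ _ w(2)] vec_scale_def[of R c "bilinear_ext R B u w"])
qed

text \<open>Linearity in the second argument follows from linearity in the first, the ring of scalars being
  commutative.\<close>

lemma bilinear_ext_flip:
  assumes B: "\<And>y y'. B y y' \<in> free_module R UNIV"
    and uv: "u \<in> free_module R UNIV" "v \<in> free_module R UNIV"
  shows "bilinear_ext R B u v = bilinear_ext R (\<lambda>y y'. B y' y) v u"
proof
  fix z
  note u = free_moduleD[OF uv(1)] and v = free_moduleD[OF uv(2)] and B' = free_moduleD(1)[OF B]
  let ?f = "\<lambda>(y, y'). (u y \<otimes> v y') \<otimes> B y y' z"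
  have "(\<Oplus>p\<in>prod.swap ` (supp R v \<times> supp R u). ?f p)
      = (\<Oplus>p\<in>supp R v \<times> supp R u. ?f (prod.swap p))"
    using u v B' by (intro finsum_reindex) auto
  also have "\<dots> = finsum R (\<lambda>(y, y'). (v y \<otimes> u y') \<otimes> B y' y z) (supp R v \<times> supp R u)"
    using u v B' by (intro finsum_cong') (auto simp: m_comm)
  finally show "bilinear_ext R B u v z = bilinear_ext R (\<lambda>y y'. B y' y) v u z"
    by (simp add: bilinear_ext_def product_swap)
qed

lemma bilinear_ext_add_right:
  assumes B: "\<And>y y'. B y y' \<in> free_module R UNIV"
    and uv: "u \<in> free_module R UNIV" "v \<in> free_module R UNIV" "w \<in> free_module R UNIV"
  shows "bilinear_ext R B w (vec_add R u v)
    = vec_add R (bilinear_ext R B w u) (bilinear_ext R B w v)"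
  using uv by (simp only: bilinear_ext_flip[OF B uv(3)] bilinear_ext_add_left[OF B]
      vec_add_free_module)

lemma bilinear_ext_scale_right:
  assumes B: "\<And>y y'. B y y' \<in> free_module R UNIV"
    and cu: "c \<in> carrier R" "u \<in> free_module R UNIV" "w \<in> free_module R UNIV"
  shows "bilinear_ext R B w (vec_scale R c u) = vec_scale R c (bilinear_ext R B w u)"
  using cu by (simp only: bilinear_ext_flip[OF B cu(3)] bilinear_ext_scale_left[OF B]
      vec_scale_free_module)

end


section \<open>The product on all Motzkin paths\<close>

locale weighted_ring = cring k for k :: "('k, 'm) ring_scheme" (structure) +
  fixes lam :: 'k
  assumes lam_closed [simp]: "lam \<in> carrier k"
begin

abbreviation vplus (infixl \<open>\<boxplus>\<close> 65) where
  "u \<boxplus> v \<equiv> vec_add k u v"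

abbreviation vscale (infixr \<open>\<cdot>\<close> 75) where
  "c \<cdot> u \<equiv> vec_scale k c u"

abbreviation product (infixl \<open>\<diamondop>\<close> 70) where
  "u \<diamondop> v \<equiv> bilinear_ext k (valley_prod k lam) u v"

abbreviation raising (\<open>\<P>\<close>) where
  "\<P> \<equiv> linear_ext k raise"

definition link :: "('x path \<Rightarrow> 'k) \<Rightarrow> ('x path \<Rightarrow> 'k) \<Rightarrow> 'x path \<Rightarrow> 'k" (infixl \<open>\<star>\<close> 70) where
  "u \<star> v = bilinear_ext k (\<lambda>m n. basis k (m @ n)) u v"

lemma valley_prod_UNIV [simp]: "valley_prod k lam m n \<in> free_module k UNIV"
proof (induction "length m + length n" arbitrary: m n rule: less_induct)
  case less
  show ?case
  proof (cases "m = [] \<or> n = []")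
    case True
    then show ?thesis
      by (auto simp: valley_prod.simps[of k lam m n])
  next
    case False
    define a where "a = last (factors m)"
    define b where "b = hd (factors n)"
    have la: "length a \<le> length m" and lb: "length b \<le> length n"
      using False by (auto simp: a_def b_def length_last_factor length_first_factor)
    have "linear_ext k raise (valley_prod k lam (lower a) b)
        \<boxplus> linear_ext k raise (valley_prod k lam a (lower b))
        \<boxplus> lam \<cdot> linear_ext k raise (valley_prod k lam (lower a) (lower b)) \<in> free_module k UNIV"
      if "a \<noteq> []" "b \<noteq> []"
      using length_lower[OF that(1)] length_lower[OF that(2)] la lb less.hyps by simp
    then show ?thesis
      using False
      by (auto simp: valley_prod.simps[of k lam m n] Let_def vec_add_def vec_scale_def
          simp flip: a_def b_def)
  qed
qed

lemma product_UNIV [simp]: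
  "\<lbrakk>u \<in> free_module k UNIV; v \<in> free_module k UNIV\<rbrakk> \<Longrightarrow> u \<diamondop> v \<in> free_module k UNIV"
  by (rule bilinear_ext_free_module) auto

lemma link_free_module:
  "\<lbrakk>u \<in> free_module k Y; v \<in> free_module k Y'; \<And>m n. m \<in> Y \<Longrightarrow> n \<in> Y' \<Longrightarrow> m @ n \<in> Z\<rbrakk> \<Longrightarrow>
    u \<star> v \<in> free_module k Z"
  unfolding link_def by (rule bilinear_ext_free_module) auto

lemma link_UNIV [simp]:
  "\<lbrakk>u \<in> free_module k UNIV; v \<in> free_module k UNIV\<rbrakk> \<Longrightarrow> u \<star> v \<in> free_module k UNIV"
  by (rule link_free_module) auto

lemmas product_bilinear [simp] =
  bilinear_ext_add_left[of "valley_prod k lam", OF valley_prod_UNIV]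
  bilinear_ext_add_right[of "valley_prod k lam", OF valley_prod_UNIV]
  bilinear_ext_scale_left[of "valley_prod k lam", OF valley_prod_UNIV]
  bilinear_ext_scale_right[of "valley_prod k lam", OF valley_prod_UNIV]

lemma link_add [simp]:
  assumes "u \<in> free_module k UNIV" "v \<in> free_module k UNIV" "w \<in> free_module k UNIV"
  shows "(u \<boxplus> v) \<star> w = u \<star> w \<boxplus> v \<star> w" "w \<star> (u \<boxplus> v) = w \<star> u \<boxplus> w \<star> v"
  using assms by (simp_all add: link_def bilinear_ext_add_left bilinear_ext_add_right)

lemma link_scale [simp]:
  assumes "c \<in> carrier k" "u \<in> free_module k UNIV" "w \<in> free_module k UNIV"
  shows "(c \<cdot> u) \<star> w = c \<cdot> (u \<star> w)" "w \<star> (c \<cdot> u) = c \<cdot> (w \<star> u)"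
  using assms by (simp_all add: link_def bilinear_ext_scale_left bilinear_ext_scale_right)

lemma product_basis: "basis k m \<diamondop> basis k n = valley_prod k lam m n"
  by (rule bilinear_ext_basis) simp

lemma link_basis [simp]: "basis k m \<star> basis k n = basis k (m @ n)"
  unfolding link_def by (rule bilinear_ext_basis) simp

text \<open>The linearity of both sides is spelled out in the premises, so that the simplifier can
  discharge it in the applications.\<close>

lemma vec_eqI:
  fixes f g :: "('y \<Rightarrow> 'k) \<Rightarrow> 'x path \<Rightarrow> 'k"
  assumes "\<And>u. u \<in> free_module k UNIV \<Longrightarrow> f u \<in> free_module k UNIV"
    and "\<And>u v. u \<in> free_module k UNIV \<Longrightarrow> v \<in> free_module k UNIV \<Longrightarrow> f (u \<boxplus> v) = f u \<boxplus> f v"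
    and "\<And>c u. c \<in> carrier k \<Longrightarrow> u \<in> free_module k UNIV \<Longrightarrow> f (c \<cdot> u) = c \<cdot> f u"
    and "\<And>u. u \<in> free_module k UNIV \<Longrightarrow> g u \<in> free_module k UNIV"
    and "\<And>u v. u \<in> free_module k UNIV \<Longrightarrow> v \<in> free_module k UNIV \<Longrightarrow> g (u \<boxplus> v) = g u \<boxplus> g v"
    and "\<And>c u. c \<in> carrier k \<Longrightarrow> u \<in> free_module k UNIV \<Longrightarrow> g (c \<cdot> u) = c \<cdot> g u"
    and "\<And>y. y \<in> Y \<Longrightarrow> f (basis k y) = g (basis k y)" "u \<in> free_module k Y"
  shows "f u = g u"
proof (rule linear_map_eqI[where f = f and g = g, OF module_path_algebra _ _ assms(7,8)])
  show "linear_map k Y (path_algebra k lam UNIV) f" "linear_map k Y (path_algebra k lam UNIV) g"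
    using assms(1-6) by (auto simp: linear_map_def)
qed

text \<open>
  Associativity and the compatibility with links are identities between expressions in three
  vectors. If both sides are trilinear, it suffices to check them for paths.
\<close>

definition trilinear ::
  "(('y \<Rightarrow> 'k) \<Rightarrow> ('y \<Rightarrow> 'k) \<Rightarrow> ('y \<Rightarrow> 'k) \<Rightarrow> 'x path \<Rightarrow> 'k) \<Rightarrow> bool" where
  "trilinear f \<longleftrightarrow> (\<forall>u\<in>free_module k UNIV. \<forall>v\<in>free_module k UNIV. \<forall>w\<in>free_module k UNIV.
    f u v w \<in> free_module k UNIV \<and>
    (\<forall>u'\<in>free_module k UNIV. f (u \<boxplus> u') v w = f u v w \<boxplus> f u' v w \<and>
      f v (u \<boxplus> u') w = f v u w \<boxplus> f v u' w \<and> f v w (u \<boxplus> u') = f v w u \<boxplus> f v w u') \<and>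
    (\<forall>c\<in>carrier k. f (c \<cdot> u) v w = c \<cdot> f u v w \<and> f u (c \<cdot> v) w = c \<cdot> f u v w \<and>
      f u v (c \<cdot> w) = c \<cdot> f u v w))"

lemma trilinear_eqI:
  assumes f: "trilinear f" and g: "trilinear g"
    and basis: "\<And>x y z. x \<in> U \<Longrightarrow> y \<in> V \<Longrightarrow> z \<in> W \<Longrightarrow>
      f (basis k x) (basis k y) (basis k z) = g (basis k x) (basis k y) (basis k z)"
    and "u \<in> free_module k U" "v \<in> free_module k V" "w \<in> free_module k W"
  shows "f u v w = g u v w"
proof -
  have UNIV: "u \<in> free_module k UNIV" "v \<in> free_module k UNIV" "w \<in> free_module k UNIV"
    using assms free_module_UNIV by blast+
  have 1: "f (basis k x) (basis k y) w = g (basis k x) (basis k y) w" if "x \<in> U" "y \<in> V" for x y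
    by (rule vec_eqI[where f = "f (basis k x) (basis k y)" and Y = W])
      (use f g that basis assms(6) in \<open>auto simp: trilinear_def\<close>)
  have 2: "f (basis k x) v w = g (basis k x) v w" if "x \<in> U" for x
    by (rule vec_eqI[where f = "\<lambda>v. f (basis k x) v w" and Y = V])
      (use f g that 1 assms(5) UNIV in \<open>auto simp: trilinear_def\<close>)
  show ?thesis
    by (rule vec_eqI[where f = "\<lambda>u. f u v w" and Y = U])
      (use f g 2 assms(4) UNIV in \<open>auto simp: trilinear_def\<close>)
qed

lemma trilinear_compose:
  "trilinear (\<lambda>u v w. u \<diamondop> v \<diamondop> w)" "trilinear (\<lambda>u v w. u \<diamondop> (v \<diamondop> w))"
  "trilinear (\<lambda>u v w. u \<star> v \<diamondop> w)" "trilinear (\<lambda>u v w. u \<star> (v \<diamondop> w))"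
  "trilinear (\<lambda>u v w. u \<diamondop> v \<star> w)" "trilinear (\<lambda>u v w. u \<diamondop> (v \<star> w))"
  "trilinear (\<lambda>u v w. u \<star> v \<star> w)" "trilinear (\<lambda>u v w. u \<star> (v \<star> w))"
  by (simp_all add: trilinear_def)

lemma link_assoc:
  assumes "u \<in> free_module k UNIV" "v \<in> free_module k UNIV" "w \<in> free_module k UNIV"
  shows "u \<star> v \<star> w = u \<star> (v \<star> w)"
  by (rule trilinear_eqI[OF trilinear_compose(7,8) _ assms]) simp

lemma linear_ext_link:
  assumes "u \<in> free_module k UNIV"
  shows "linear_ext k (\<lambda>q. m @ q @ n) u = basis k m \<star> u \<star> basis k n"
  by (rule vec_eqI[where g = "\<lambda>u. basis k m \<star> u \<star> basis k n", OF _ _ _ _ _ _ _ assms]) simp_all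

lemma product_trivial [simp]:
  assumes "u \<in> free_module k UNIV"
  shows "basis k [] \<diamondop> u = u" "u \<diamondop> basis k [] = u"
proof -
  show "basis k [] \<diamondop> u = u"
    by (rule vec_eqI[where f = "\<lambda>u. basis k [] \<diamondop> u" and g = "\<lambda>u. u", OF _ _ _ _ _ _ _ assms])
      (simp_all add: product_basis valley_prod_trivial)
  show "u \<diamondop> basis k [] = u"
    by (rule vec_eqI[where f = "\<lambda>u. u \<diamondop> basis k []" and g = "\<lambda>u. u", OF _ _ _ _ _ _ _ assms])
      (simp_all add: product_basis valley_prod_trivial)
qed

lemma product_split:
  assumes "m \<in> motzkin_paths X" "n \<in> motzkin_paths X"
    and "a \<in> irreducible_paths X" "b \<in> irreducible_paths X"
  shows "basis k (m @ a) \<diamondop> basis k (b @ n)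
    = basis k m \<star> (basis k a \<diamondop> basis k b) \<star> basis k n"
proof -
  obtain ms ns where "m = concat ms" "set ms \<subseteq> irreducible_paths X"
    "n = concat ns" "set ns \<subseteq> irreducible_paths X"
    using motzkin_concat_irreducible assms(1,2) by metis
  then have "valley_prod k lam (m @ a) (b @ n)
      = linear_ext k (\<lambda>q. m @ q @ n) (valley_prod k lam a b)"
    using valley_prod_factors[OF lam_closed, of ms a b ns X] assms(3,4)
    by (auto simp: irreducible_paths_def)
  then show ?thesis
    by (simp add: product_basis linear_ext_link)
qed

text \<open>
  Where no valley arises, one of the two factors that meet is a level step, and the product is
  the link product.
\<close>

lemma product_no_valley:
  assumes "m \<in> motzkin_paths X" "n \<in> motzkin_paths X" "m \<noteq> []" "n \<noteq> []"
    and "\<not> (last m = Down \<and> hd n = Up)"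
  shows "basis k m \<diamondop> basis k n = basis k (m @ n)"
proof -
  obtain m' a where a: "m = m' @ a" "m' \<in> motzkin_paths X" "a \<in> irreducible_paths X"
    using split_last_factor assms by blast
  obtain b n' where b: "n = b @ n'" "b \<in> irreducible_paths X" "n' \<in> motzkin_paths X"
    using split_first_factor assms by blast
  have "\<not> (last a = Down \<and> hd b = Up)"
    using assms(5) a(1) b(1) irreducible_not_Nil[OF a(3)] irreducible_not_Nil[OF b(2)] by auto
  then obtain x where "a = [Level x] \<or> b = [Level x]"
    using a(3) b(2) by (elim irreducible_cases) (auto simp: raise_def)
  then have "basis k a \<diamondop> basis k b = basis k (a @ b)"
    using a(3) b(2) valley_prod_level[of a X b x lam]
    by (auto simp: product_basis irreducible_paths_def)
  then show ?thesis
    using product_split[of m' X n' a b] a b by simp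
qed

lemma product_raise:
  assumes "m \<in> motzkin_paths X" "n \<in> motzkin_paths X"
  shows "basis k (raise m) \<diamondop> basis k (raise n) =
    \<P> (basis k m \<diamondop> basis k (raise n)) \<boxplus> \<P> (basis k (raise m) \<diamondop> basis k n)
      \<boxplus> lam \<cdot> \<P> (basis k m \<diamondop> basis k n)"
  using valley_prod_raise[OF lam_closed assms] by (simp add: product_basis vec_add_def vec_scale_def)

lemma product_level_left:
  assumes "x \<in> X" "u \<in> free_module k (motzkin_paths X)"
  shows "basis k [Level x] \<diamondop> u = basis k [Level x] \<star> u"
proof (rule vec_eqI[where f = "\<lambda>u. basis k [Level x] \<diamondop> u" and g = "\<lambda>u. basis k [Level x] \<star> u",
      OF _ _ _ _ _ _ _ assms(2)])
  fix n assume "n \<in> motzkin_paths X"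
  then show "basis k [Level x] \<diamondop> basis k n = basis k [Level x] \<star> basis k n"
    using product_no_valley[of "[Level x]" X n] assms(1) by (cases "n = []") auto
qed (use assms in auto)

lemma product_level_right:
  assumes "x \<in> X" "u \<in> free_module k (motzkin_paths X)"
  shows "u \<diamondop> basis k [Level x] = u \<star> basis k [Level x]"
proof (rule vec_eqI[where f = "\<lambda>u. u \<diamondop> basis k [Level x]" and g = "\<lambda>u. u \<star> basis k [Level x]",
      OF _ _ _ _ _ _ _ assms(2)])
  fix m assume "m \<in> motzkin_paths X"
  then show "basis k m \<diamondop> basis k [Level x] = basis k m \<star> basis k [Level x]"
    using product_no_valley[of m X "[Level x]"] assms(1) by (cases "m = []") auto
qed (use assms in auto)

text \<open>
  The product only affects the factors that meet; all others are carried along by the link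
  product.
\<close>

lemma link_product:
  assumes "u \<in> free_module k (motzkin_paths X)" "v \<in> free_module k (motzkin_paths X - {[]})"
    and "w \<in> free_module k (motzkin_paths X)"
  shows "u \<star> v \<diamondop> w = u \<star> (v \<diamondop> w)"
proof (rule trilinear_eqI[OF trilinear_compose(3,4) _ assms])
  fix m n p
  assume m: "m \<in> motzkin_paths X" and n: "n \<in> motzkin_paths X - {[]}" and p: "p \<in> motzkin_paths X"
  obtain n' a where a: "n = n' @ a" "n' \<in> motzkin_paths X" "a \<in> irreducible_paths X"
    using split_last_factor n by blast
  show "basis k m \<star> basis k n \<diamondop> basis k p = basis k m \<star> (basis k n \<diamondop> basis k p)"
  proof (cases "p = []")
    case False
    then obtain b p' where b: "p = b @ p'" "b \<in> irreducible_paths X" "p' \<in> motzkin_paths X"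
      using split_first_factor p by blast
    have "basis k (m @ n) \<diamondop> basis k p
        = basis k (m @ n') \<star> (basis k a \<diamondop> basis k b) \<star> basis k p'"
      using product_split[of "m @ n'" X p' a b] a b m by (simp add: motzkin_append)
    also have "\<dots> = basis k m \<star> (basis k n' \<star> (basis k a \<diamondop> basis k b) \<star> basis k p')"
      by (simp flip: link_basis add: link_assoc)
    finally show ?thesis
      using product_split[of n' X p' a b] a b by simp
  qed simp
qed

lemma product_link:
  assumes "u \<in> free_module k (motzkin_paths X)" "v \<in> free_module k (motzkin_paths X - {[]})"
    and "w \<in> free_module k (motzkin_paths X)"
  shows "u \<diamondop> (v \<star> w) = u \<diamondop> v \<star> w"
proof (rule trilinear_eqI[OF trilinear_compose(6,5) _ assms])
  fix m n p
  assume m: "m \<in> motzkin_paths X" and n: "n \<in> motzkin_paths X - {[]}" and p: "p \<in> motzkin_paths X"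
  obtain b n' where b: "n = b @ n'" "b \<in> irreducible_paths X" "n' \<in> motzkin_paths X"
    using split_first_factor n by blast
  show "basis k m \<diamondop> (basis k n \<star> basis k p) = basis k m \<diamondop> basis k n \<star> basis k p"
  proof (cases "m = []")
    case False
    then obtain m' a where a: "m = m' @ a" "m' \<in> motzkin_paths X" "a \<in> irreducible_paths X"
      using split_last_factor m by blast
    have "basis k m \<diamondop> basis k (n @ p)
        = basis k m' \<star> (basis k a \<diamondop> basis k b) \<star> basis k (n' @ p)"
      using product_split[of m' X "n' @ p" a b] a b p by (simp add: motzkin_append)
    also have "\<dots> = basis k m' \<star> (basis k a \<diamondop> basis k b) \<star> basis k n' \<star> basis k p"
      by (simp flip: link_basis add: link_assoc)
    finally show ?thesis
      using product_split[of m' X n' a b] a b by simp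
  qed simp
qed

text \<open>
  The product never creates a valley: where two raised paths meet, it replaces them by single raised
  paths. The condition on the trivial path makes sure that a product with a non-trivial factor is
  again a combination of non-trivial paths, as the compatibility with links requires.
\<close>

lemma product_basis_class:
  assumes "m \<in> path_class X vf pf" "n \<in> path_class X vf pf"
  shows "basis k m \<diamondop> basis k n \<in> free_module k {q \<in> path_class X vf pf. q = [] \<longrightarrow> m @ n = []}"
  using assms
proof (induction "length m + length n" arbitrary: m n rule: less_induct)
  case less
  have mot: "m \<in> motzkin_paths X" "n \<in> motzkin_paths X"
    using less.prems path_class_subset by blast+
  show ?case
  proof (cases "m = [] \<or> n = []")
    case True
    then show ?thesis using less.prems by auto
  next
    case False
    obtain m' a where a: "m = m' @ a" "m' \<in> motzkin_paths X" "a \<in> irreducible_paths X"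
      using split_last_factor mot False by blast
    obtain b n' where b: "n = b @ n'" "b \<in> irreducible_paths X" "n' \<in> motzkin_paths X"
      using split_first_factor mot False by blast
    have mn: "basis k m \<diamondop> basis k n = linear_ext k (\<lambda>q. m' @ q @ n') (basis k a \<diamondop> basis k b)"
      using product_split[of m' X n' a b] a b by (simp add: linear_ext_link)
    show ?thesis
    proof (cases "last m = Down \<and> hd n = Up")
      case no_valley: False
      then have "m @ n \<in> path_class X vf pf"
        using less.prems by (intro path_class_append) auto
      then show ?thesis
        using product_no_valley[OF mot _ _ no_valley] False by simp
    next
      case True
      then have "last a = Down" "hd b = Up"
        using a(1) b(1) irreducible_not_Nil[OF a(3)] irreducible_not_Nil[OF b(2)] by auto
      then have no_level: "\<nexists>x. a = [Level x] \<or> b = [Level x]"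
        by auto
      obtain q where q: "q \<in> motzkin_paths X" "a = raise q"
        using a(3) no_level by (cases rule: irreducible_cases) auto
      obtain r where r: "r \<in> motzkin_paths X" "b = raise r"
        using b(2) no_level by (cases rule: irreducible_cases) auto
      let ?C = "path_class X vf pf"
      have ab: "a \<in> ?C" "b \<in> ?C"
        using path_class_appendD(2)[of m' a] path_class_appendD(1)[of b n'] less.prems a b
          irreducible_motzkin irreducible_not_Nil by blast+
      then have qr: "q \<in> ?C" "r \<in> ?C"
        using q r by (auto simp: path_class_raise)
      have len: "length q < length a" "length r < length b" "length a \<le> length m" "length b \<le> length n"
        using a b q r by (auto simp: raise_def)
      have IH: "basis k m \<diamondop> basis k n \<in> free_module k ?C"
        if "m \<in> ?C" "n \<in> ?C" "length m + length n < length a + length b" for m n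
        using less.hyps[of m n] that len by (auto intro: free_module_mono[rotated])
      have P: "\<P> u \<in> free_module k (raise ` ?C)" if "u \<in> free_module k ?C" for u
        using that by (rule linear_ext_free_module) auto
      have "basis k q \<diamondop> basis k b \<in> free_module k ?C" "basis k a \<diamondop> basis k r \<in> free_module k ?C"
        "basis k q \<diamondop> basis k r \<in> free_module k ?C"
        using ab qr len by (intro IH; simp)+
      then have "basis k a \<diamondop> basis k b \<in> free_module k (raise ` ?C)"
        unfolding q(2) r(2) product_raise[OF q(1) r(1)]
        by (intro vec_add_free_module vec_scale_free_module P lam_closed)
      moreover have "m' @ s @ n' \<in> {q \<in> ?C. q = [] \<longrightarrow> m @ n = []}" if s: "s \<in> raise ` ?C" for s
      proof -
        obtain t where t: "t \<in> ?C" "s = raise t"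
          using s by blast
        have "m' @ raise t @ n' \<in> ?C"
          using less.prems a b q r t by (intro path_class_replace[of m' q X vf pf r n' t]) simp_all
        then show ?thesis
          by (simp add: t raise_def)
      qed
      ultimately have "linear_ext k (\<lambda>q. m' @ q @ n') (basis k a \<diamondop> basis k b)
          \<in> free_module k {q \<in> ?C. q = [] \<longrightarrow> m @ n = []}"
        by (rule linear_ext_free_module)
      then show ?thesis by (simp add: mn)
    qed
  qed
qed

lemma product_class:
  assumes "u \<in> free_module k (path_class X vf pf)" "v \<in> free_module k (path_class X vf pf)"
  shows "u \<diamondop> v \<in> free_module k (path_class X vf pf)"
  using assms
proof (rule bilinear_ext_free_module)
  fix m n
  assume "m \<in> path_class X vf pf" "n \<in> path_class X vf pf"
  then show "valley_prod k lam m n \<in> free_module k (path_class X vf pf)"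
    using product_basis_class[of m X vf pf n]
    by (auto simp: product_basis intro: free_module_mono[rotated])
qed

lemmas product_motzkin = product_class[where vf = False and pf = False, unfolded path_class_motzkin]

lemma product_nontrivial:
  assumes "m \<in> motzkin_paths X" "n \<in> motzkin_paths X" "m \<noteq> [] \<or> n \<noteq> []"
  shows "basis k m \<diamondop> basis k n \<in> free_module k (motzkin_paths X - {[]})"
proof -
  have "{q \<in> motzkin_paths X. q = [] \<longrightarrow> m @ n = []} \<subseteq> motzkin_paths X - {[]}"
    using assms(3) by auto
  then show ?thesis
    using product_basis_class[of m X False False n] assms
    by (auto simp: path_class_motzkin intro: free_module_mono)
qed

lemma raise_motzkin_free_module:
  "u \<in> free_module k (motzkin_paths X) \<Longrightarrow> \<P> u \<in> free_module k (motzkin_paths X)"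
  by (rule linear_ext_free_module) (auto intro: raise_motzkin)

text \<open>The defining recursion of the product, extended bilinearly.\<close>

lemma product_op:
  assumes uv: "u \<in> free_module k (motzkin_paths X)" "v \<in> free_module k (motzkin_paths X)"
  shows "\<P> u \<diamondop> \<P> v = \<P> (u \<diamondop> \<P> v) \<boxplus> \<P> (\<P> u \<diamondop> v) \<boxplus> lam \<cdot> \<P> (u \<diamondop> v)"
proof -
  have add: "a \<boxplus> a' \<boxplus> (b \<boxplus> b') \<boxplus> lam \<cdot> (c \<boxplus> c')
      = a \<boxplus> b \<boxplus> lam \<cdot> c \<boxplus> (a' \<boxplus> b' \<boxplus> lam \<cdot> c')"
    if "a \<in> free_module k UNIV" "b \<in> free_module k UNIV" "c \<in> free_module k UNIV"
      "a' \<in> free_module k UNIV" "b' \<in> free_module k UNIV" "c' \<in> free_module k UNIV"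
    for a b c a' b' c' :: "'x path \<Rightarrow> 'k"
    using that by (simp add: vec_ac vec_scale_add)
  have scale: "d \<cdot> a \<boxplus> d \<cdot> b \<boxplus> lam \<cdot> d \<cdot> c = d \<cdot> (a \<boxplus> b \<boxplus> lam \<cdot> c)"
    if "a \<in> free_module k UNIV" "b \<in> free_module k UNIV" "c \<in> free_module k UNIV" "d \<in> carrier k"
    for a b c :: "'x path \<Rightarrow> 'k" and d
    using that by (simp add: vec_scale_add vec_scale_commute[of lam d])
  have uvU: "u \<in> free_module k UNIV" "v \<in> free_module k UNIV"
    using uv free_module_UNIV by blast+
  have basis: "\<P> (basis k m) \<diamondop> \<P> v
      = \<P> (basis k m \<diamondop> \<P> v) \<boxplus> \<P> (\<P> (basis k m) \<diamondop> v) \<boxplus> lam \<cdot> \<P> (basis k m \<diamondop> v)"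
    if "m \<in> motzkin_paths X" for m
    by (rule vec_eqI[where f = "\<lambda>v. \<P> (basis k m) \<diamondop> \<P> v" and
        g = "\<lambda>v. \<P> (basis k m \<diamondop> \<P> v) \<boxplus> \<P> (\<P> (basis k m) \<diamondop> v) \<boxplus> lam \<cdot> \<P> (basis k m \<diamondop> v)",
        OF _ _ _ _ _ _ _ uv(2)])
      (simp_all add: add scale product_raise[OF that])
  show ?thesis
    by (rule vec_eqI[where f = "\<lambda>u. \<P> u \<diamondop> \<P> v" and
        g = "\<lambda>u. \<P> (u \<diamondop> \<P> v) \<boxplus> \<P> (\<P> u \<diamondop> v) \<boxplus> lam \<cdot> \<P> (u \<diamondop> v)",
        OF _ _ _ _ _ _ _ uv(1)])
      (simp_all add: add scale basis[simplified] uvU)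
qed


section \<open>Associativity\<close>

text \<open>
  Expanding the product of three raised vectors by the Rota--Baxter identity in either order
  gives the same seven terms, once the products with fewer raised factors are
  known to associate.
\<close>

lemma product_assoc_op:
  assumes xyz: "x \<in> free_module k (motzkin_paths X)" "y \<in> free_module k (motzkin_paths X)"
      "z \<in> free_module k (motzkin_paths X)"
    and "x \<diamondop> y \<diamondop> z = x \<diamondop> (y \<diamondop> z)"
    and "\<P> x \<diamondop> y \<diamondop> z = \<P> x \<diamondop> (y \<diamondop> z)"
    and "x \<diamondop> \<P> y \<diamondop> z = x \<diamondop> (\<P> y \<diamondop> z)"
    and "x \<diamondop> y \<diamondop> \<P> z = x \<diamondop> (y \<diamondop> \<P> z)"
    and "\<P> x \<diamondop> \<P> y \<diamondop> z = \<P> x \<diamondop> (\<P> y \<diamondop> z)"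
    and "\<P> x \<diamondop> y \<diamondop> \<P> z = \<P> x \<diamondop> (y \<diamondop> \<P> z)"
    and "x \<diamondop> \<P> y \<diamondop> \<P> z = x \<diamondop> (\<P> y \<diamondop> \<P> z)"
  shows "\<P> x \<diamondop> \<P> y \<diamondop> \<P> z = \<P> x \<diamondop> (\<P> y \<diamondop> \<P> z)"
proof -
  note assoc = assms(4-)
  note closed = product_motzkin raise_motzkin_free_module
  have xyzU: "x \<in> free_module k UNIV" "y \<in> free_module k UNIV" "z \<in> free_module k UNIV"
    using xyz free_module_UNIV by blast+
  have left: "\<P> x \<diamondop> \<P> y \<diamondop> \<P> z =
    \<P> (x \<diamondop> \<P> y \<diamondop> \<P> z) \<boxplus> \<P> (\<P> (x \<diamondop> \<P> y) \<diamondop> z) \<boxplus> lam \<cdot> \<P> (x \<diamondop> \<P> y \<diamondop> z)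
    \<boxplus> (\<P> (\<P> x \<diamondop> y \<diamondop> \<P> z) \<boxplus> \<P> (\<P> (\<P> x \<diamondop> y) \<diamondop> z) \<boxplus> lam \<cdot> \<P> (\<P> x \<diamondop> y \<diamondop> z))
    \<boxplus> lam \<cdot> (\<P> (x \<diamondop> y \<diamondop> \<P> z) \<boxplus> \<P> (\<P> (x \<diamondop> y) \<diamondop> z) \<boxplus> lam \<cdot> \<P> (x \<diamondop> y \<diamondop> z))"
    using product_op[of x X y] product_op[of "x \<diamondop> \<P> y" X z] product_op[of "\<P> x \<diamondop> y" X z]
      product_op[of "x \<diamondop> y" X z] xyz xyzU by (simp add: closed)
  have right: "\<P> x \<diamondop> (\<P> y \<diamondop> \<P> z) =
    \<P> (x \<diamondop> \<P> (y \<diamondop> \<P> z)) \<boxplus> \<P> (\<P> x \<diamondop> (y \<diamondop> \<P> z)) \<boxplus> lam \<cdot> \<P> (x \<diamondop> (y \<diamondop> \<P> z))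
    \<boxplus> (\<P> (x \<diamondop> \<P> (\<P> y \<diamondop> z)) \<boxplus> \<P> (\<P> x \<diamondop> (\<P> y \<diamondop> z)) \<boxplus> lam \<cdot> \<P> (x \<diamondop> (\<P> y \<diamondop> z)))
    \<boxplus> lam \<cdot> (\<P> (x \<diamondop> \<P> (y \<diamondop> z)) \<boxplus> \<P> (\<P> x \<diamondop> (y \<diamondop> z)) \<boxplus> lam \<cdot> \<P> (x \<diamondop> (y \<diamondop> z)))"
    using product_op[of y X z] product_op[of x X "y \<diamondop> \<P> z"] product_op[of x X "\<P> y \<diamondop> z"]
      product_op[of x X "y \<diamondop> z"] xyz xyzU by (simp add: closed)
  \<comment> \<open>On either side, the Rota--Baxter identity recombines the three terms in which the operator is
    nested inside a product into one term.\<close>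
  have sum1: "\<P> (\<P> x \<diamondop> (\<P> y \<diamondop> z)) = \<P> (\<P> (x \<diamondop> \<P> y) \<diamondop> z) \<boxplus> \<P> (\<P> (\<P> x \<diamondop> y) \<diamondop> z) \<boxplus> lam \<cdot> \<P> (\<P> (x \<diamondop> y) \<diamondop> z)"
    using product_op[of x X y] xyz xyzU by (simp flip: assoc(5))
  have sum2: "\<P> (x \<diamondop> (\<P> y \<diamondop> \<P> z))
      = \<P> (x \<diamondop> \<P> (y \<diamondop> \<P> z)) \<boxplus> \<P> (x \<diamondop> \<P> (\<P> y \<diamondop> z)) \<boxplus> lam \<cdot> \<P> (x \<diamondop> \<P> (y \<diamondop> z))"
    using product_op[of y X z] xyz xyzU by simp
  have regroup:
    "(t \<boxplus> p1 \<boxplus> b) \<boxplus> (c \<boxplus> p2 \<boxplus> d) \<boxplus> lam \<cdot> (e \<boxplus> p3 \<boxplus> f) =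
      (q1 \<boxplus> c \<boxplus> lam \<cdot> e) \<boxplus> (q2 \<boxplus> s \<boxplus> b) \<boxplus> lam \<cdot> (q3 \<boxplus> d' \<boxplus> f)"
    if "s = p1 \<boxplus> p2 \<boxplus> lam \<cdot> p3" "t = q1 \<boxplus> q2 \<boxplus> lam \<cdot> q3" "d = lam \<cdot> d'"
      "p1 \<in> free_module k UNIV" "p2 \<in> free_module k UNIV" "p3 \<in> free_module k UNIV"
      "q1 \<in> free_module k UNIV" "q2 \<in> free_module k UNIV" "q3 \<in> free_module k UNIV"
      "b \<in> free_module k UNIV" "c \<in> free_module k UNIV" "d' \<in> free_module k UNIV"
      "e \<in> free_module k UNIV" "f \<in> free_module k UNIV"
    for b c d d' e f p1 p2 p3 q1 q2 q3 s t :: "'x path \<Rightarrow> 'k"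
    using that(4-) unfolding that(1-3) by (simp add: vec_ac vec_scale_add)
  show ?thesis
    unfolding left right assoc by (rule regroup[OF sum1 sum2 refl]) (simp_all add: xyzU)
qed

text \<open>
  If the middle path has several factors, the two products do not interact, and if it is a level step,
  both are link products. If an outer path has several factors, only the one next to the middle path
  takes part, and the induction hypothesis applies to it. An outer level step links as well.
  This leaves three raised paths.
\<close>

lemma product_assoc_basis:
  assumes "m \<in> motzkin_paths X" "n \<in> motzkin_paths X" "p \<in> motzkin_paths X"
  shows "basis k m \<diamondop> basis k n \<diamondop> basis k p = basis k m \<diamondop> (basis k n \<diamondop> basis k p)"
  using assms
proof (induction "length m + length n + length p" arbitrary: m n p rule: less_induct)
  case less
  let ?M = "motzkin_paths X"
  have basis: "basis k q \<in> free_module k ?M" if "q \<in> ?M" for q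
    using that by simp
  have basis': "basis k q \<in> free_module k (?M - {[]})" if "q \<in> ?M" "q \<noteq> []" for q
    using that by simp
  show ?case
  proof (cases "m = [] \<or> n = [] \<or> p = []")
    case True
    then show ?thesis by auto
  next
    case False
    obtain n1 n2 where n: "n = n1 @ n2" "n1 \<in> irreducible_paths X" "n2 \<in> ?M"
      using split_first_factor less.prems False by blast
    obtain m1 m2 where m: "m = m1 @ m2" "m1 \<in> ?M" "m2 \<in> irreducible_paths X"
      using split_last_factor less.prems False by blast
    obtain p1 p2 where p: "p = p1 @ p2" "p1 \<in> irreducible_paths X" "p2 \<in> ?M"
      using split_first_factor less.prems False by blast
    note irr = m(3) n(2) p(2)
    note mot = irr[THEN irreducible_motzkin] and ne = irr[THEN irreducible_not_Nil]
    consider (n) "n2 \<noteq> []" | (m) "m1 \<noteq> []" | (p) "p2 \<noteq> []" | (irr) "m1 = []" "n2 = []" "p2 = []"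
      by blast
    then show ?thesis
    proof cases
      case n: n
      have "basis k m \<diamondop> (basis k n1 \<star> basis k n2) \<diamondop> basis k p
          = basis k m \<diamondop> basis k n1 \<star> basis k n2 \<diamondop> basis k p"
        using less.prems mot ne n \<open>n2 \<in> ?M\<close> by (subst product_link[of _ X]) auto
      also have "\<dots> = basis k m \<diamondop> basis k n1 \<star> (basis k n2 \<diamondop> basis k p)"
        using less.prems mot ne n \<open>n2 \<in> ?M\<close>
        by (intro link_product[of _ X] product_motzkin basis basis')
      also have "\<dots> = basis k m \<diamondop> (basis k n1 \<star> (basis k n2 \<diamondop> basis k p))"
        using less.prems mot ne n \<open>n2 \<in> ?M\<close>
        by (intro product_link[symmetric, of _ X] product_motzkin basis basis')
      also have "\<dots> = basis k m \<diamondop> (basis k n1 \<star> basis k n2 \<diamondop> basis k p)"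
        using less.prems mot ne n \<open>n2 \<in> ?M\<close> by (subst link_product[of _ X]) auto
      finally show ?thesis
        using \<open>n = n1 @ n2\<close> by simp
    next
      case m: m
      have IH: "basis k m2 \<diamondop> basis k n \<diamondop> basis k p = basis k m2 \<diamondop> (basis k n \<diamondop> basis k p)"
        using less.prems mot m \<open>m = m1 @ m2\<close> by (intro less.hyps) auto
      have "basis k m1 \<star> basis k m2 \<diamondop> basis k n \<diamondop> basis k p
          = basis k m1 \<star> (basis k m2 \<diamondop> basis k n) \<diamondop> basis k p"
        using less.prems mot ne \<open>m1 \<in> ?M\<close> by (subst link_product[of _ X]) auto
      also have "\<dots> = basis k m1 \<star> (basis k m2 \<diamondop> basis k n \<diamondop> basis k p)"
        using less.prems mot ne \<open>m1 \<in> ?M\<close>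
        by (intro link_product[of _ X] product_nontrivial basis) auto
      also have "\<dots> = basis k m1 \<star> basis k m2 \<diamondop> (basis k n \<diamondop> basis k p)"
        unfolding IH using less.prems mot ne \<open>m1 \<in> ?M\<close>
        by (intro link_product[symmetric, of _ X] product_motzkin basis basis')
      finally show ?thesis
        using \<open>m = m1 @ m2\<close> by simp
    next
      case p: p
      have IH: "basis k m \<diamondop> basis k n \<diamondop> basis k p1 = basis k m \<diamondop> (basis k n \<diamondop> basis k p1)"
        using less.prems mot p \<open>p = p1 @ p2\<close> by (intro less.hyps) auto
      have "basis k m \<diamondop> basis k n \<diamondop> (basis k p1 \<star> basis k p2)
          = basis k m \<diamondop> basis k n \<diamondop> basis k p1 \<star> basis k p2"
        using less.prems mot ne \<open>p2 \<in> ?M\<close>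
        by (intro product_link[of _ X] product_motzkin basis basis')
      also have "\<dots> = basis k m \<diamondop> (basis k n \<diamondop> basis k p1 \<star> basis k p2)"
        unfolding IH using less.prems mot ne \<open>p2 \<in> ?M\<close>
        by (intro product_link[symmetric, of _ X] product_nontrivial basis) auto
      also have "\<dots> = basis k m \<diamondop> (basis k n \<diamondop> (basis k p1 \<star> basis k p2))"
        using less.prems mot ne \<open>p2 \<in> ?M\<close> by (subst product_link[of "basis k n" X]) auto
      finally show ?thesis
        using \<open>p = p1 @ p2\<close> by simp
    next
      case irr
      then have irr: "m \<in> irreducible_paths X" "n \<in> irreducible_paths X" "p \<in> irreducible_paths X"
        using m n p by auto
      note prod = product_motzkin[OF basis basis]
      have split: "(\<exists>x\<in>X. c = [Level x]) \<or> (\<exists>q\<in>?M. c = raise q)"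
        if "c \<in> irreducible_paths X" for c
        using that by (cases rule: irreducible_cases) auto
      consider (m) x where "x \<in> X" "m = [Level x]" | (n) x where "x \<in> X" "n = [Level x]"
        | (p) x where "x \<in> X" "p = [Level x]"
        | (raise) q r s where "q \<in> ?M" "r \<in> ?M" "s \<in> ?M" "m = raise q" "n = raise r" "p = raise s"
        using split[OF irr(1)] split[OF irr(2)] split[OF irr(3)] by blast
      then show ?thesis
      proof cases
        case (m x)
        have "basis k m \<star> basis k n \<diamondop> basis k p = basis k m \<star> (basis k n \<diamondop> basis k p)"
          using less.prems False by (intro link_product[of _ X]) auto
        moreover have "basis k m \<diamondop> basis k n = basis k m \<star> basis k n"
          using product_level_left[OF m(1) basis[OF less.prems(2)]] m(2) by simp
        moreover have "basis k m \<diamondop> (basis k n \<diamondop> basis k p) = basis k m \<star> (basis k n \<diamondop> basis k p)"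
          using product_level_left[OF m(1) prod[OF less.prems(2,3)]] m(2) by simp
        ultimately show ?thesis by (simp only:)
      next
        case (n x)
        have "basis k m \<diamondop> basis k n \<diamondop> basis k p = basis k m \<star> basis k n \<diamondop> basis k p"
          using product_level_right[OF n(1) basis[OF less.prems(1)]] n(2) by simp
        also have "\<dots> = basis k m \<star> (basis k n \<diamondop> basis k p)"
          using less.prems False by (intro link_product[of _ X]) auto
        also have "\<dots> = basis k m \<star> basis k n \<star> basis k p"
          using product_level_left[OF n(1) basis[OF less.prems(3)]] n(2) by simp
        also have "\<dots> = basis k m \<diamondop> basis k n \<star> basis k p"
          using product_level_right[OF n(1) basis[OF less.prems(1)]] n(2) by simp
        also have "\<dots> = basis k m \<diamondop> (basis k n \<star> basis k p)"
          using less.prems False by (intro product_link[symmetric, of _ X]) auto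
        also have "\<dots> = basis k m \<diamondop> (basis k n \<diamondop> basis k p)"
          using product_level_left[OF n(1) basis[OF less.prems(3)]] n(2) by simp
        finally show ?thesis .
      next
        case (p x)
        have "basis k m \<diamondop> (basis k n \<star> basis k p) = basis k m \<diamondop> basis k n \<star> basis k p"
          using less.prems False by (intro product_link[of _ X]) auto
        moreover have "basis k n \<diamondop> basis k p = basis k n \<star> basis k p"
          using product_level_right[OF p(1) basis[OF less.prems(2)]] p(2) by simp
        moreover have "basis k m \<diamondop> basis k n \<diamondop> basis k p = basis k m \<diamondop> basis k n \<star> basis k p"
          using product_level_right[OF p(1) prod[OF less.prems(1,2)]] p(2) by simp
        ultimately show ?thesis by (simp only:)
      next
        case (raise q r s)
        have len: "length q < length m" "length r < length n" "length s < length p"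
          using raise by (simp_all add: raise_def)
        have IH: "basis k m' \<diamondop> basis k n' \<diamondop> basis k p' = basis k m' \<diamondop> (basis k n' \<diamondop> basis k p')"
          if "m' = m \<or> m' = q" "n' = n \<or> n' = r" "p' = p \<or> p' = s" "(m', n', p') \<noteq> (m, n, p)"
          for m' n' p'
          using that raise less.prems len by (intro less.hyps) auto
        have P: "\<P> (basis k q) = basis k m" "\<P> (basis k r) = basis k n" "\<P> (basis k s) = basis k p"
          using raise by simp_all
        have ne: "m \<noteq> q" "n \<noteq> r" "p \<noteq> s"
          using len by auto
        show ?thesis
          using product_assoc_op[of "basis k q" X "basis k r" "basis k s"] raise(1-3) ne
          unfolding P by (simp add: IH)
      qed
    qed
  qed
qed

lemma product_assoc:
  assumes "u \<in> free_module k (motzkin_paths X)" "v \<in> free_module k (motzkin_paths X)"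
    "w \<in> free_module k (motzkin_paths X)"
  shows "u \<diamondop> v \<diamondop> w = u \<diamondop> (v \<diamondop> w)"
  by (rule trilinear_eqI[OF trilinear_compose(1,2) _ assms]) (rule product_assoc_basis)

lemma rota_baxter_path_class:
  "nonunitary_rota_baxter_algebra k (path_algebra k lam (path_class X vf pf)) lam"
proof -
  interpret A: module k "path_algebra k lam (path_class X vf pf)"
    by (rule module_path_algebra)
  have M: "u \<in> free_module k (motzkin_paths X)" if "u \<in> free_module k (path_class X vf pf)" for u
    using that path_class_subset by (rule free_module_mono[rotated])
  have P: "\<P> u \<in> free_module k (path_class X vf pf)" if "u \<in> free_module k (path_class X vf pf)" for u
    using that path_class_subset[of X vf pf]
    by (auto intro!: linear_ext_free_module simp: path_class_raise subset_iff)
  show ?thesis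
    by unfold_locales
      (auto simp: product_class P intro: product_assoc[of _ X] product_op[of _ X] M)
qed

end


section \<open>Evaluation of paths in a Rota--Baxter algebra\<close>

text \<open>
  The unit enters the product of the empty list only, so that the products of the other lists make sense in
  a nonunitary algebra, where the field \<open>one\<close> may be any element of the type.
\<close>

fun list_product :: "('k, 'a) rb_algebra \<Rightarrow> 'a list \<Rightarrow> 'a" where
  "list_product A [] = \<one>\<^bsub>A\<^esub>"
| "list_product A [a] = a"
| "list_product A (a # b # cs) = a \<otimes>\<^bsub>A\<^esub> list_product A (b # cs)"

lemma length_factor:
  assumes "c \<in> set (factors m)"
  shows "length c \<le> length m"
proof -
  obtain as bs where "factors m = as @ c # bs"
    using assms by (meson split_list)
  then have "m = concat as @ c @ concat bs"
    using concat_factors[of m] by simp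
  then show ?thesis by simp
qed

text \<open>The arbitrary value is never taken on a Motzkin path, none of whose factors begins with a down
  step.\<close>

function eval_path :: "('k, 'a) rb_algebra \<Rightarrow> ('x \<Rightarrow> 'a) \<Rightarrow> 'x path \<Rightarrow> 'a" where
  "eval_path A f m = list_product A (map (\<lambda>c. case hd c of
      Up \<Rightarrow> rb_op A (eval_path A f (lower c)) | Level x \<Rightarrow> f x | Down \<Rightarrow> undefined) (factors m))"
  by pat_completeness auto
termination
proof (relation "measure (\<lambda>(A, f, m). length m)", goal_cases)
  case (2 A f m c)
  then have "length c \<le> length m"
    by (intro length_factor)
  moreover have "m \<noteq> []"
    using 2 by (auto simp: factors_def)
  ultimately have "length (lower c) < length m"
    by (cases m) (auto simp: lower_def)
  then show ?case by simp
qed simp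

declare eval_path.simps [simp del]

lemma path_class_factors:
  assumes "m \<in> path_class X vf pf" "c \<in> set (factors m)"
  shows "c \<in> irreducible_paths X" "c \<in> path_class X vf pf"
proof -
  have m: "m \<in> motzkin_paths X"
    using assms(1) path_class_subset by blast
  then obtain cs where cs: "m = concat cs" "set cs \<subseteq> irreducible_paths X"
    using motzkin_concat_irreducible by blast
  then have c: "c \<in> set cs"
    using assms(2) by (simp add: factors_concat_irreducible)
  then show irr: "c \<in> irreducible_paths X"
    using cs(2) by blast
  have mot: "concat ds \<in> motzkin_paths X" if "set ds \<subseteq> irreducible_paths X" for ds
    using that by (induction ds) (auto intro: motzkin_append irreducible_motzkin)
  obtain as bs where ab: "cs = as @ c # bs"
    using c by (meson split_list)
  then have "concat as \<in> motzkin_paths X" "concat bs \<in> motzkin_paths X"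
    using cs(2) by (auto intro: mot)
  moreover have "m = concat as @ c @ concat bs"
    using cs(1) ab by simp
  ultimately show "c \<in> path_class X vf pf"
    using path_class_appendD(2)[of "concat as" "c @ concat bs" X vf pf]
      path_class_appendD(1)[of c "concat bs" X vf pf] assms(1) irr
    by (simp add: irreducible_not_Nil irreducible_motzkin motzkin_append)
qed

text \<open>
  Excluding peaks and the trivial path allows targets without unit; if they are admitted,
  the target must have one.
\<close>

locale path_evaluation =
  weighted_ring k lam + A: nonunitary_rota_baxter_algebra k A lam
  for k :: "('k, 'm) ring_scheme" (structure) and lam and A :: "('k, 'a) rb_algebra" +
  fixes X :: "'x set" and f :: "'x \<Rightarrow> 'a" and pf :: bool
  assumes f_closed: "x \<in> X \<Longrightarrow> f x \<in> carrier A"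
    and unital: "\<not> pf \<Longrightarrow> rota_baxter_algebra k A lam"
begin

lemma list_product_closed:
  "\<lbrakk>set cs \<subseteq> carrier A; cs \<noteq> []\<rbrakk> \<Longrightarrow> list_product A cs \<in> carrier A"
  by (induction cs rule: induct_list012) (auto simp: A.mult_closed)

lemma list_product_append:
  "\<lbrakk>set cs \<subseteq> carrier A; set ds \<subseteq> carrier A; cs \<noteq> []; ds \<noteq> []\<rbrakk> \<Longrightarrow>
    list_product A (cs @ ds) = list_product A cs \<otimes>\<^bsub>A\<^esub> list_product A ds"
proof (induction cs rule: induct_list012)
  case (2 a)
  then show ?case by (cases ds) auto
qed (auto simp: A.mult_assoc list_product_closed)

abbreviation ev where "ev \<equiv> eval_path A f"

abbreviation evaluable where "evaluable \<equiv> path_class X False pf"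

lemma ev_Nil: "ev [] = \<one>\<^bsub>A\<^esub>"
  by (subst eval_path.simps) (simp add: factors_def)

lemma ev_Level: "ev [Level x] = f x"
  by (subst eval_path.simps) (simp add: factors_def)

lemma hd_raise: "hd (raise m) = Up"
  by (simp add: raise_def)

lemma ev_raise: "m \<in> motzkin_paths X \<Longrightarrow> ev (raise m) = rb_op A (ev m)"
  using factors_irreducible[OF irreducible_raise[of m X]] hd_raise[of m]
  by (subst eval_path.simps) simp

lemma ev_closed: "m \<in> evaluable \<Longrightarrow> ev m \<in> carrier A"
proof (induction "length m" arbitrary: m rule: less_induct)
  case less
  show ?case
  proof (cases "m = []")
    case True
    then have "\<not> pf"
      using less.prems by simp
    then interpret rota_baxter_algebra k A lam
      by (rule unital)
    show ?thesis
      using True unit_closed by (simp add: ev_Nil)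
  next
    case False
    have "(case hd c of Up \<Rightarrow> rb_op A (ev (lower c)) | Level x \<Rightarrow> f x | Down \<Rightarrow> undefined)
        \<in> carrier A" if c: "c \<in> set (factors m)" for c
    proof -
      have len: "length c \<le> length m"
        using c by (rule length_factor)
      from path_class_factors(1)[OF less.prems c] show ?thesis
      proof (cases rule: irreducible_cases)
        case (level x)
        then show ?thesis by (simp add: f_closed)
      next
        case (raise q)
        then have "q \<in> evaluable"
          using path_class_factors(2)[OF less.prems c] by (simp add: path_class_raise)
        then have "ev q \<in> carrier A"
          using len raise by (intro less.hyps) (auto simp: raise_def)
        moreover have "hd c = Up" "lower c = q"
          using raise by (simp_all add: raise_def[of q] lower_def)
        ultimately show ?thesis by (simp add: A.op_closed)
      qed
    qed
    moreover have "factors m \<noteq> []"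
      using False concat_factors[of m] by auto
    ultimately show ?thesis
      by (subst eval_path.simps) (auto intro!: list_product_closed)
  qed
qed

lemma ev_append:
  assumes "m \<in> evaluable" "n \<in> evaluable"
  shows "ev (m @ n) = ev m \<otimes>\<^bsub>A\<^esub> ev n"
proof (cases "m = [] \<or> n = []")
  case True
  then have "\<not> pf"
    using assms by auto
  then interpret rota_baxter_algebra k A lam
    by (rule unital)
  show ?thesis
    using True ev_closed[OF assms(1)] ev_closed[OF assms(2)]
    by (auto simp: ev_Nil mult_unit_left mult_unit_right)
next
  case False
  define v where "v = (\<lambda>c. case hd c of Up \<Rightarrow> rb_op A (ev (lower c)) | Level x \<Rightarrow> f x
    | Down \<Rightarrow> undefined)"
  have ev: "ev q = list_product A (map v (factors q))" for q
    by (subst eval_path.simps) (simp add: v_def)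
  have v: "v c = ev c" if "c \<in> irreducible_paths X" for c
    by (simp add: ev factors_irreducible[OF that])
  have "set (map v (factors q)) \<subseteq> carrier A" if "q \<in> evaluable" for q
    using path_class_factors[OF that] v ev_closed by auto
  moreover have "factors m \<noteq> []" "factors n \<noteq> []"
    using False concat_factors[of m] concat_factors[of n] by auto
  moreover have "factors (m @ n) = factors m @ factors n"
    using assms path_class_subset by (intro factors_append[of _ X]) blast+
  ultimately show ?thesis
    using assms by (simp add: ev list_product_append)
qed

definition hom where "hom = lin_comb k A ev"

lemma module_A: "module k A" ..

lemma hom_linear: "linear_map k evaluable A hom"
  unfolding hom_def using ev_closed by (intro linear_map_lin_comb module_A) auto

lemma hom_basis: "m \<in> evaluable \<Longrightarrow> hom (basis k m) = ev m"
  unfolding hom_def using ev_closed by (intro lin_comb_basis[of A _ evaluable] module_A) auto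

lemma hom_simps:
  "u \<in> free_module k evaluable \<Longrightarrow> hom u \<in> carrier A"
  "u \<in> free_module k evaluable \<Longrightarrow> v \<in> free_module k evaluable \<Longrightarrow> hom (u \<boxplus> v) = hom u \<oplus>\<^bsub>A\<^esub> hom v"
  "c \<in> carrier k \<Longrightarrow> u \<in> free_module k evaluable \<Longrightarrow> hom (c \<cdot> u) = c \<odot>\<^bsub>A\<^esub> hom u"
  using hom_linear by (auto simp: linear_map_def)

lemma evaluable_motzkin: "m \<in> evaluable \<Longrightarrow> m \<in> motzkin_paths X"
  using path_class_subset by blast

lemma op_evaluable: "u \<in> free_module k evaluable \<Longrightarrow> \<P> u \<in> free_module k evaluable"
  using path_class_raise[OF evaluable_motzkin] by (blast intro: linear_ext_free_module)

lemma link_evaluable: "u \<in> free_module k evaluable \<Longrightarrow> v \<in> free_module k evaluable \<Longrightarrow> u \<star> v \<in> free_module k evaluable"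
  by (rule link_free_module) (auto intro: path_class_append_valley)

text \<open>Used for the link product and for the product alike.\<close>

lemma hom_bilinear_eqI:
  assumes closed: "\<And>u v. u \<in> free_module k evaluable \<Longrightarrow> v \<in> free_module k evaluable \<Longrightarrow> B u v \<in> free_module k evaluable"
    and add: "\<And>u v w. u \<in> free_module k UNIV \<Longrightarrow> v \<in> free_module k UNIV \<Longrightarrow> w \<in> free_module k UNIV \<Longrightarrow>
        B (u \<boxplus> v) w = B u w \<boxplus> B v w \<and> B w (u \<boxplus> v) = B w u \<boxplus> B w v"
    and scale: "\<And>c u v. c \<in> carrier k \<Longrightarrow> u \<in> free_module k UNIV \<Longrightarrow> v \<in> free_module k UNIV \<Longrightarrow>
        B (c \<cdot> u) v = c \<cdot> B u v \<and> B u (c \<cdot> v) = c \<cdot> B u v"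
    and basis: "\<And>m n. m \<in> evaluable \<Longrightarrow> n \<in> evaluable \<Longrightarrow> hom (B (basis k m) (basis k n)) = ev m \<otimes>\<^bsub>A\<^esub> ev n"
    and uv: "u \<in> free_module k evaluable" "v \<in> free_module k evaluable"
  shows "hom (B u v) = hom u \<otimes>\<^bsub>A\<^esub> hom v"
proof -
  have 1: "hom (B (basis k m) v) = ev m \<otimes>\<^bsub>A\<^esub> hom v" if "m \<in> evaluable" for m
    by (rule linear_map_eqI[OF module_A, where f = "\<lambda>v. hom (B (basis k m) v)" and Y = evaluable
          and g = "\<lambda>v. ev m \<otimes>\<^bsub>A\<^esub> hom v", OF _ _ _ uv(2)])
      (use that in \<open>simp_all add: linear_map_def closed add scale basis hom_simps hom_basis ev_closed
        A.mult_closed A.mult_add_right A.mult_smult_right\<close>)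
  show ?thesis
    by (rule linear_map_eqI[OF module_A, where f = "\<lambda>u. hom (B u v)" and Y = evaluable
          and g = "\<lambda>u. hom u \<otimes>\<^bsub>A\<^esub> hom v", OF _ _ _ uv(1)])
      (use uv 1 in \<open>simp_all add: linear_map_def closed add scale hom_simps hom_basis ev_closed
        A.mult_closed A.mult_add_left A.mult_smult_left\<close>)
qed

lemma hom_link:
  assumes "u \<in> free_module k evaluable" "v \<in> free_module k evaluable"
  shows "hom (u \<star> v) = hom u \<otimes>\<^bsub>A\<^esub> hom v"
  by (rule hom_bilinear_eqI[OF _ _ _ _ assms])
    (simp_all add: link_evaluable hom_basis path_class_append_valley ev_append)

lemma hom_op:
  assumes "u \<in> free_module k evaluable"
  shows "hom (\<P> u) = rb_op A (hom u)"
  by (rule linear_map_eqI[OF module_A, where f = "\<lambda>u. hom (\<P> u)" and Y = evaluable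
        and g = "\<lambda>u. rb_op A (hom u)", OF _ _ _ assms])
    (simp_all add: linear_map_def op_evaluable hom_simps hom_basis ev_closed A.op_closed A.op_add A.op_smult
      ev_raise evaluable_motzkin path_class_raise)

text \<open>
  Factors that do not meet are split off by means of the link product, which the evaluation respects
  by construction. For two raised paths, both sides satisfy the recursion given by the
  Rota--Baxter identity.
\<close>

lemma hom_product_basis:
  assumes "m \<in> evaluable" "n \<in> evaluable"
  shows "hom (basis k m \<diamondop> basis k n) = ev m \<otimes>\<^bsub>A\<^esub> ev n"
  using assms
proof (induction "length m + length n" arbitrary: m n rule: less_induct)
  case less
  have mot: "m \<in> motzkin_paths X" "n \<in> motzkin_paths X"
    using less.prems evaluable_motzkin by blast+
  show ?case
  proof (cases "m = [] \<or> n = []")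
    case True
    then have "hom (basis k m \<diamondop> basis k n) = ev (m @ n)"
      using less.prems by (auto simp: hom_basis)
    then show ?thesis
      using less.prems by (simp add: ev_append)
  next
    case False
    obtain m' a where a: "m = m' @ a" "m' \<in> motzkin_paths X" "a \<in> irreducible_paths X"
      using split_last_factor mot False by blast
    obtain b n' where b: "n = b @ n'" "b \<in> irreducible_paths X" "n' \<in> motzkin_paths X"
      using split_first_factor mot False by blast
    have ab: "a \<in> evaluable" "b \<in> evaluable" "m' \<noteq> [] \<Longrightarrow> m' \<in> evaluable" "n' \<noteq> [] \<Longrightarrow> n' \<in> evaluable" "a \<noteq> []" "b \<noteq> []"
      using path_class_appendD[of m' a] path_class_appendD[of b n'] less.prems a b
        irreducible_motzkin irreducible_not_Nil by metis+
    note abm = a(3)[THEN irreducible_motzkin] b(2)[THEN irreducible_motzkin]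
    have prod_evaluable: "basis k p \<diamondop> basis k q \<in> free_module k evaluable" if "p \<in> evaluable" "q \<in> evaluable" for p q
      using that by (intro product_class) simp_all
    show ?thesis
    proof (cases "m' = [] \<and> n' = []")
      case False
      then consider (m) "m' \<noteq> []" | (n) "n' \<noteq> []" by blast
      then show ?thesis
      proof cases
        case m
        have "basis k m' \<star> basis k a \<diamondop> basis k n = basis k m' \<star> (basis k a \<diamondop> basis k n)"
          using a mot abm ab by (intro link_product[of _ X]) simp_all
        moreover have "hom (basis k a \<diamondop> basis k n) = ev a \<otimes>\<^bsub>A\<^esub> ev n"
          using a m ab less.prems by (intro less.hyps) simp_all
        ultimately show ?thesis
          using a m ab less.prems prod_evaluable
          by (simp add: hom_link hom_basis ev_append A.mult_assoc ev_closed)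
      next
        case n
        have "basis k m \<diamondop> (basis k b \<star> basis k n') = basis k m \<diamondop> basis k b \<star> basis k n'"
          using b mot abm ab by (intro product_link[of _ X]) simp_all
        moreover have "hom (basis k m \<diamondop> basis k b) = ev m \<otimes>\<^bsub>A\<^esub> ev b"
          using b n ab less.prems by (intro less.hyps) simp_all
        ultimately show ?thesis
          using b n ab less.prems prod_evaluable
          by (simp add: hom_link hom_basis ev_append A.mult_assoc ev_closed)
      qed
    next
      case True
      show ?thesis
      proof (cases "last m = Down \<and> hd n = Up")
        case no_valley: False
        then show ?thesis
          using product_no_valley[OF mot _ _ no_valley] False less.prems
          by (simp add: hom_basis path_class_append_valley ev_append)
      next
        case valley: True
        obtain q where q: "q \<in> motzkin_paths X" "m = raise q"
          using a True valley by (elim irreducible_cases) auto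
        obtain r where r: "r \<in> motzkin_paths X" "n = raise r"
          using b True valley by (elim irreducible_cases) auto
        have qr: "q \<in> evaluable" "r \<in> evaluable"
          using less.prems q r by (simp_all add: path_class_raise)
        have len: "length q < length m" "length r < length n"
          using q r by (simp_all add: raise_def)
        have IH: "hom (basis k q \<diamondop> basis k n) = ev q \<otimes>\<^bsub>A\<^esub> ev n"
          "hom (basis k m \<diamondop> basis k r) = ev m \<otimes>\<^bsub>A\<^esub> ev r"
          "hom (basis k q \<diamondop> basis k r) = ev q \<otimes>\<^bsub>A\<^esub> ev r"
          using len qr less.prems by (auto intro: less.hyps)
        have "hom (basis k m \<diamondop> basis k n) = rb_op A (ev q \<otimes>\<^bsub>A\<^esub> ev n) \<oplus>\<^bsub>A\<^esub> rb_op A (ev m \<otimes>\<^bsub>A\<^esub> ev r)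
            \<oplus>\<^bsub>A\<^esub> lam \<odot>\<^bsub>A\<^esub> rb_op A (ev q \<otimes>\<^bsub>A\<^esub> ev r)"
          using product_raise[OF q(1) r(1)] prod_evaluable qr less.prems IH
          by (simp add: hom_simps hom_op op_evaluable flip: q(2) r(2))
        also have "\<dots> = ev m \<otimes>\<^bsub>A\<^esub> ev n"
          using A.rota_baxter[OF ev_closed[OF qr(1)] ev_closed[OF qr(2)]] q r by (simp add: ev_raise)
        finally show ?thesis .
      qed
    qed
  qed
qed

lemma hom_product:
  assumes "u \<in> free_module k evaluable" "v \<in> free_module k evaluable"
  shows "hom (u \<diamondop> v) = hom u \<otimes>\<^bsub>A\<^esub> hom v"
  by (rule hom_bilinear_eqI[OF _ _ _ _ assms])
    (simp_all add: product_class hom_product_basis)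


section \<open>The universal property\<close>

abbreviation U where "U \<equiv> path_algebra k lam (path_class X True pf)"

lemma U_mult_closed:
  "u \<in> carrier U \<Longrightarrow> v \<in> carrier U \<Longrightarrow> u \<diamondop> v \<in> carrier U"
  "u \<in> carrier U \<Longrightarrow> \<P> u \<in> carrier U"
  using rota_baxter_path_class[of X True pf]
    nonunitary_rota_baxter_algebra.mult_closed[of k U lam u v]
    nonunitary_rota_baxter_algebra.op_closed[of k U lam u] by simp_all

lemma hom_restrict:
  "restrict hom (carrier U) \<in> nonunitary_rb_hom k U A \<inter> extensional (carrier U)"
proof -
  have evaluable: "u \<in> free_module k evaluable" if "u \<in> free_module k (path_class X True pf)" for u
    using that path_class_allow_valleys by (rule free_module_mono[rotated])
  show ?thesis
    using U_mult_closed
    by (auto simp: nonunitary_rb_hom_def evaluable hom_simps hom_product hom_op)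
qed

lemma hom_restrict_gen: "x \<in> X \<Longrightarrow> restrict hom (carrier U) (path_gen k x) = f x"
  by (simp add: path_gen_def hom_basis path_class_Level ev_Level)

lemma hom_restrict_one: "\<not> pf \<Longrightarrow> restrict hom (carrier U) (basis k []) = \<one>\<^bsub>A\<^esub>"
  by (simp add: hom_basis ev_Nil)

lemma hom_unique:
  assumes g: "g \<in> nonunitary_rb_hom k U A \<inter> extensional (carrier U)"
      "\<And>x. x \<in> X \<Longrightarrow> f x = g (path_gen k x)" "\<not> pf \<Longrightarrow> g (basis k []) = \<one>\<^bsub>A\<^esub>"
  shows "g = restrict hom (carrier U)"
proof -
  have lin: "linear_map k (path_class X True pf) A g"
    "linear_map k (path_class X True pf) A (restrict hom (carrier U))"
    using g(1) hom_restrict by (auto simp: linear_map_def nonunitary_rb_hom_def)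
  have basis: "g (basis k m) = ev m" if "m \<in> path_class X True pf" for m
    using that
  proof (induction rule: valley_free_induct)
    case trivial
    then show ?case using g(3) by (simp add: ev_Nil)
  next
    case (level x)
    then show ?case using g(2) by (simp add: path_gen_def ev_Level)
  next
    case (raise m)
    then have "m \<in> motzkin_paths X"
      using path_class_subset by blast
    moreover have "g (\<P> (basis k m)) = rb_op A (g (basis k m))"
      using g(1) raise by (simp add: nonunitary_rb_hom_def del: linear_ext_basis)
    ultimately show ?case
      using raise by (simp add: ev_raise)
  next
    case (link m n)
    \<comment> \<open>No valley arises, so the linked path is the product of the two parts and not just a term of it.\<close>
    then have "basis k m \<diamondop> basis k n = basis k (m @ n)"
      using path_class_subset by (intro product_no_valley[of _ X]) blast+
    moreover have "g (basis k m \<diamondop> basis k n) = g (basis k m) \<otimes>\<^bsub>A\<^esub> g (basis k n)"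
      using g(1) link by (simp add: nonunitary_rb_hom_def)
    moreover have "m \<in> evaluable" "n \<in> evaluable"
      using link path_class_allow_valleys by blast+
    ultimately show ?case
      using link by (simp add: ev_append)
  qed
  have "g u = restrict hom (carrier U) u" if "u \<in> carrier U" for u
  proof (rule linear_map_eqI[OF module_A lin])
    show "u \<in> free_module k (path_class X True pf)"
      using that by simp
  next
    fix m assume m: "m \<in> path_class X True pf"
    then have "m \<in> evaluable"
      using path_class_allow_valleys by blast
    then show "g (basis k m) = restrict hom (carrier U) (basis k m)"
      using m by (simp add: basis hom_basis)
  qed
  then show ?thesis
    using g(1) hom_restrict by (intro extensionalityI[of g "carrier U"]) auto
qed

end

lemma (in weighted_ring) free_valley_free_paths:
  "free_rota_baxter_algebra TYPE('r) k lam X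
    (path_algebra k lam (path_class X True False)) (path_gen k)"
  unfolding free_rota_baxter_algebra_def
proof (intro conjI allI impI)
  let ?U = "path_algebra k lam (path_class X True False)"
  interpret U: nonunitary_rota_baxter_algebra k ?U lam
    by (rule rota_baxter_path_class)
  show "rota_baxter_algebra k ?U lam"
    by unfold_locales simp_all
  show "path_gen k \<in> X \<rightarrow> carrier ?U"
    by (simp add: path_gen_def path_class_Level)
  fix A :: "('k, 'r) rb_algebra" and f
  assume A: "rota_baxter_algebra k A lam" and f: "f \<in> X \<rightarrow> carrier A"
  interpret A: rota_baxter_algebra k A lam by fact
  interpret path_evaluation k lam A X f False
    using A f by unfold_locales auto
  show "\<exists>!h. h \<in> rb_hom k ?U A \<inter> extensional (carrier ?U) \<and> (\<forall>x\<in>X. f x = h (path_gen k x))"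
  proof (rule ex1I[of _ "restrict hom (carrier ?U)"])
    show "restrict hom (carrier ?U) \<in> rb_hom k ?U A \<inter> extensional (carrier ?U) \<and>
        (\<forall>x\<in>X. f x = restrict hom (carrier ?U) (path_gen k x))"
      using hom_restrict hom_restrict_gen hom_restrict_one by (auto simp: rb_hom_def)
  next
    fix g
    assume "g \<in> rb_hom k ?U A \<inter> extensional (carrier ?U) \<and> (\<forall>x\<in>X. f x = g (path_gen k x))"
    then show "g = restrict hom (carrier ?U)"
      by (intro hom_unique) (auto simp: rb_hom_def)
  qed
qed

lemma (in weighted_ring) free_valley_peak_free_paths:
  "free_nonunitary_rota_baxter_algebra TYPE('r) k lam X
    (path_algebra k lam (path_class X True True)) (path_gen k)"
  unfolding free_nonunitary_rota_baxter_algebra_def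
proof (intro conjI allI impI)
  let ?U = "path_algebra k lam (path_class X True True)"
  show "nonunitary_rota_baxter_algebra k ?U lam"
    by (rule rota_baxter_path_class)
  show "path_gen k \<in> X \<rightarrow> carrier ?U"
    by (simp add: path_gen_def path_class_Level)
  fix A :: "('k, 'r) rb_algebra" and f
  assume A: "nonunitary_rota_baxter_algebra k A lam" and f: "f \<in> X \<rightarrow> carrier A"
  interpret A: nonunitary_rota_baxter_algebra k A lam by fact
  interpret path_evaluation k lam A X f True
    using f by unfold_locales auto
  show "\<exists>!h. h \<in> nonunitary_rb_hom k ?U A \<inter> extensional (carrier ?U) \<and>
      (\<forall>x\<in>X. f x = h (path_gen k x))"
  proof (rule ex1I[of _ "restrict hom (carrier ?U)"])
    show "restrict hom (carrier ?U) \<in> nonunitary_rb_hom k ?U A \<inter> extensional (carrier ?U) \<and>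
        (\<forall>x\<in>X. f x = restrict hom (carrier ?U) (path_gen k x))"
      using hom_restrict hom_restrict_gen by simp
  next
    fix g
    assume "g \<in> nonunitary_rb_hom k ?U A \<inter> extensional (carrier ?U) \<and>
      (\<forall>x\<in>X. f x = g (path_gen k x))"
    then show "g = restrict hom (carrier ?U)"
      by (intro hom_unique) auto
  qed
qed

theorem corollary6p3:
  fixes k :: "('k, 'm) ring_scheme" and lam :: 'k and X :: "'x set"
  assumes "cring k" and "lam \<in> carrier k" and "X \<noteq> {}"
  shows "free_rota_baxter_algebra TYPE('r) k lam X
      (path_algebra k lam (valley_free_paths X)) (path_gen k) \<and>
    free_nonunitary_rota_baxter_algebra TYPE('s) k lam X
      (path_algebra k lam (valley_free_paths X \<inter> peak_free_paths X)) (path_gen k)"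
proof -
  interpret weighted_ring k lam
    using assms by (simp add: weighted_ring_def weighted_ring_axioms_def)
  show ?thesis
    using free_valley_free_paths[of X] free_valley_peak_free_paths[of X]
    by (simp add: path_class_valley_free path_class_valley_peak_free)
qed

end
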